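(* Let $n\ge1$. The map $\Phi:\mathcal F(\mathbf G^\dagger)\to\mathcal F(\mathbf G^\dagger_0)\otimes\mathcal F(\mathbf N)$, $\Phi(f)(\lambda,\nu)=f(\lambda\circ\nu)$, is an isomorphism of Hopf algebras, where the target carries the Hopf algebra structure of the bicrossed product $\mathcal F(\mathbf G^\dagger_0)\,{\blacktriangleright\!<}\,\mathcal F(\mathbf N)$.
   Context: $\mathbf G^\dagger$ is the group of orientation preserving diffeomorphisms $\psi$ of $\mathbb R^n$ with $\psi(0)=0$; $\mathbf G^\dagger_0\subset\mathbf G^\dagger$ is the subgroup of linear maps $\lambda(x)=\mathbf a\cdot x$; $\mathbf N=\{\nu\in\mathbf G^\dagger:\nu'(0)=\mathrm{Id}\}$. Every $\psi\in\mathbf G^\dagger$ is uniquely $\psi=\lambda_\psi\circ\nu_\psi$ with $\lambda_\psi(x)=\psi'(0)x$ and $\nu_\psi\in\mathbf N$. $\mathbf G^\dagger_0$ acts on $\mathbf N$ from the right by $\nu\triangleleft\lambda=\lambda^{-1}\circ\nu\circ\lambda$. $\mathcal F(\mathbf G^\dagger)$ is the unital algebra of functions on $\mathbf G^\dagger$ generated by $\beta^i_{j_1,\ldots,j_k}(\psi)=\partial_{j_k}\cdots\partial_{j_1}\psi^i(0)$ ($k\ge1$) and $\beta^{-1}(\psi)=1/\det\psi'(0)$. $\mathcal F(\mathbf G^\dagger_0)$ is the algebra generated by $\alpha^i_j(\lambda)=\partial_j\lambda^i(0)$ and $\alpha^{-1}(\lambda)=1/\det\mathbf a$ (i.e. the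 regular functions on $\mathrm{GL}_n$). $\mathcal F(\mathbf N)$ is the algebra generated by the restrictions $\alpha^i_{j_1,\ldots,j_k}(\nu)=\partial_{j_k}\cdots\partial_{j_1}\nu^i(0)$, $k\ge2$. All three are Hopf algebras with $\Delta(f)(\psi_1,\psi_2)=f(\psi_1\circ\psi_2)$, $\varepsilon(f)=f(e)$, $S(f)(\psi)=f(\psi^{-1})$. The right coaction $f\mapsto f_{\langle0\rangle}\otimes f_{\langle1\rangle}\in\mathcal F(\mathbf N)\otimes\mathcal F(\mathbf G^\dagger_0)$ is defined by $f_{\langle0\rangle}(\nu)f_{\langle1\rangle}(\lambda)=f(\nu\triangleleft\lambda)$. The Hopf algebra $\mathcal F(\mathbf G^\dagger_0)\,{\blacktriangleright\!<}\,\mathcal F(\mathbf N)$ is the tensor product algebra with coproduct $\Delta(f^1\otimes f^2)=\bigl(f^1_{(1)}\otimes f^2_{(1)\langle0\rangle}\bigr)\otimes\bigl(f^1_{(2)}f^2_{(1)\langle1\rangle}\otimes f^2_{(2)}\bigr)$ and counit $\varepsilon\otimes\varepsilon$. *)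

theory Defs
  imports "HOL-Analysis.Analysis"
begin

definition partial_deriv :: "'n::finite \<Rightarrow> (real^'n \<Rightarrow> real) \<Rightarrow> real^'n \<Rightarrow> real" where
  "partial_deriv j f x = deriv (\<lambda>t. f (x + t *\<^sub>R axis j 1)) 0"

text \<open>The first index in the list is the first one to be applied: for \<open>js = [j1, ..., jk]\<close> this is
  \<open>d_jk (... (d_j1 f))\<close>.\<close>

definition iter_partial :: "'n::finite list \<Rightarrow> (real^'n \<Rightarrow> real) \<Rightarrow> real^'n \<Rightarrow> real" where
  "iter_partial js f = fold partial_deriv js f"

text \<open>Since differentiable functions are continuous and have partial derivatives, requiring all
  iterated partial derivatives to be differentiable is the same as \<open>f\<close> being of class \<open>C^\<infinity>\<close>.\<close>

definition smooth :: "(real^'n::finite \<Rightarrow> real) \<Rightarrow> bool" where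
  "smooth f \<longleftrightarrow> (\<forall>js. iter_partial js f differentiable_on UNIV)"

definition smooth_map :: "(real^'n::finite \<Rightarrow> real^'n) \<Rightarrow> bool" where
  "smooth_map \<psi> \<longleftrightarrow> (\<forall>i. smooth (\<lambda>x. \<psi> x $ i))"

definition orientation_preserving_diffeo :: "(real^'n::finite \<Rightarrow> real^'n) \<Rightarrow> bool" where
  "orientation_preserving_diffeo \<psi> \<longleftrightarrow>
     bij \<psi> \<and> smooth_map \<psi> \<and> smooth_map (inv \<psi>) \<and> (\<forall>x. det (jacobian \<psi> (at x)) > 0)"

lemma partial_deriv_eq:
  assumes "(f has_derivative D) (at x)"
  shows "partial_deriv j f x = D (axis j 1)"
proof -
  have l: "((\<lambda>t. x + t *\<^sub>R axis j (1::real)) has_derivative (\<lambda>t. t *\<^sub>R axis j 1)) (at 0)"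
    by (auto intro!: derivative_eq_intros)
  have "((\<lambda>t. f (x + t *\<^sub>R axis j 1)) has_derivative (\<lambda>t. D (t *\<^sub>R axis j 1))) (at 0)"
    by (rule has_derivative_compose[OF l]) (use assms in simp)
  moreover have "(\<lambda>t. D (t *\<^sub>R axis j 1)) = (\<lambda>t. t * D (axis j 1))"
    using has_derivative_linear[OF assms] by (auto simp: linear_cmul)
  ultimately have "((\<lambda>t. f (x + t *\<^sub>R axis j 1)) has_field_derivative D (axis j 1)) (at 0)"
    by (simp add: has_field_derivative_def mult.commute[of _ "D (axis j 1)"] mult_commute_abs)
  then show ?thesis
    unfolding partial_deriv_def by (rule DERIV_imp_deriv)
qed

fun Cdiff :: "nat \<Rightarrow> (real^'n::finite \<Rightarrow> real) \<Rightarrow> bool" where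
  "Cdiff 0 f \<longleftrightarrow> (\<forall>x. f differentiable (at x))"
| "Cdiff (Suc k) f \<longleftrightarrow> (\<forall>x. f differentiable (at x)) \<and> (\<forall>j. Cdiff k (partial_deriv j f))"

lemma Cdiff_differentiable: "Cdiff k f \<Longrightarrow> f differentiable (at x)"
  by (cases k) auto

lemma Cdiff_Suc: "Cdiff (Suc k) f \<Longrightarrow> Cdiff k f"
  by (induction k arbitrary: f) auto

lemma smooth_iff: "smooth f \<longleftrightarrow> (\<forall>js x. iter_partial js f differentiable (at x))"
  by (auto simp: smooth_def differentiable_on_def)

lemma smooth_partial: "smooth f \<Longrightarrow> smooth (partial_deriv j f)"
  unfolding smooth_iff
proof (intro allI)
  fix js x
  assume "\<forall>js x. iter_partial js f differentiable (at x)"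
  then have "iter_partial (j # js) f differentiable (at x)" by blast
  then show "iter_partial js (partial_deriv j f) differentiable (at x)"
    by (simp add: iter_partial_def)
qed

lemma smooth_differentiable: "smooth f \<Longrightarrow> f differentiable (at x)"
  unfolding smooth_iff by (metis iter_partial_def fold_Nil id_apply)

lemma smooth_imp_Cdiff: "smooth f \<Longrightarrow> Cdiff k f"
  by (induction k arbitrary: f) (auto simp: smooth_differentiable smooth_partial)

lemma Cdiff_iter: "Cdiff (length js) f \<Longrightarrow> iter_partial js f differentiable (at x)"
  by (induction js arbitrary: f) (auto simp: iter_partial_def)

lemma smooth_iff_Cdiff: "smooth f \<longleftrightarrow> (\<forall>k. Cdiff k f)"
  using smooth_imp_Cdiff Cdiff_iter unfolding smooth_iff by blast

lemma partial_deriv_const: "partial_deriv j (\<lambda>x. c) = (\<lambda>x. 0)"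
  using partial_deriv_eq[OF has_derivative_const] by auto

lemma Cdiff_const: "Cdiff k (\<lambda>x. c)"
  by (induction k arbitrary: c) (auto simp: partial_deriv_const)

lemma Cdiff_linear:
  fixes f :: "real^'n::finite \<Rightarrow> real"
  assumes "linear f"
  shows "Cdiff k f"
proof -
  have d: "(f has_derivative f) (at x)" for x
    using assms by (rule linear_imp_has_derivative)
  have "partial_deriv j f = (\<lambda>x. f (axis j 1))" for j
    using partial_deriv_eq[OF d] by auto
  then show ?thesis
    using d by (cases k) (auto simp: Cdiff_const differentiable_def)
qed

lemma Cdiff_add: "Cdiff k f \<Longrightarrow> Cdiff k g \<Longrightarrow> Cdiff k (\<lambda>x. f x + g x)"
proof (induction k arbitrary: f g)
  case 0
  then show ?case by auto
next
  case (Suc k)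
  have "partial_deriv j (\<lambda>x. f x + g x) = (\<lambda>x. partial_deriv j f x + partial_deriv j g x)" for j
  proof
    fix x
    obtain D E where D: "(f has_derivative D) (at x)" and E: "(g has_derivative E) (at x)"
      using Suc.prems by (auto simp: differentiable_def) metis
    show "partial_deriv j (\<lambda>x. f x + g x) x = partial_deriv j f x + partial_deriv j g x"
      using partial_deriv_eq[OF has_derivative_add[OF D E]] partial_deriv_eq[OF D]
        partial_deriv_eq[OF E] by simp
  qed
  then show ?case using Suc by auto
qed

lemma Cdiff_mult: "Cdiff k f \<Longrightarrow> Cdiff k g \<Longrightarrow> Cdiff k (\<lambda>x. f x * g x)"
proof (induction k arbitrary: f g)
  case 0
  then show ?case by auto
next
  case (Suc k)
  have "partial_deriv j (\<lambda>x. f x * g x)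
      = (\<lambda>x. f x * partial_deriv j g x + partial_deriv j f x * g x)" for j
  proof
    fix x
    obtain D E where D: "(f has_derivative D) (at x)" and E: "(g has_derivative E) (at x)"
      using Suc.prems by (auto simp: differentiable_def) metis
    show "partial_deriv j (\<lambda>x. f x * g x) x = f x * partial_deriv j g x + partial_deriv j f x * g x"
      using partial_deriv_eq[OF has_derivative_mult[OF D E]] partial_deriv_eq[OF D]
        partial_deriv_eq[OF E] by simp
  qed
  moreover have "Cdiff k f" "Cdiff k g"
    using Suc.prems Cdiff_Suc by blast+
  ultimately show ?case using Suc by (auto intro!: Cdiff_add Suc.IH)
qed

lemma Cdiff_sum: "finite I \<Longrightarrow> (\<And>i. i \<in> I \<Longrightarrow> Cdiff k (f i)) \<Longrightarrow> Cdiff k (\<lambda>x. \<Sum>i\<in>I. f i x)"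
  by (induction I rule: finite_induct) (auto intro: Cdiff_add Cdiff_const)

lemma has_derivative_vec_components:
  fixes \<psi> :: "real^'n::finite \<Rightarrow> real^'n"
  assumes "\<And>i. ((\<lambda>x. \<psi> x $ i) has_derivative D i) (at x)"
  shows "(\<psi> has_derivative (\<lambda>h. \<chi> i. D i h)) (at x)"
proof -
  have "((\<lambda>x. \<psi> x \<bullet> b) has_derivative (\<lambda>h. (\<chi> i. D i h) \<bullet> b)) (at x)" if "b \<in> Basis" for b
  proof -
    obtain i where "b = axis i 1"
      using \<open>b \<in> Basis\<close> by (auto simp: Basis_vec_def)
    then show ?thesis
      using assms[of i] by (simp add: inner_axis)
  qed
  then show ?thesis
    by (subst has_derivative_componentwise_within) auto
qed

lemma partial_deriv_compose:
  fixes f :: "real^'n::finite \<Rightarrow> real" and g :: "real^'n \<Rightarrow> real^'n"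
  assumes f: "f differentiable (at (g x))" and g: "\<And>i. (\<lambda>x. g x $ i) differentiable (at x)"
  shows "partial_deriv j (\<lambda>x. f (g x)) x
      = (\<Sum>i\<in>UNIV. partial_deriv i f (g x) * partial_deriv j (\<lambda>x. g x $ i) x)"
    and "(\<lambda>x. f (g x)) differentiable (at x)"
proof -
  obtain F where F: "(f has_derivative F) (at (g x))"
    using f by (auto simp: differentiable_def)
  obtain D where D: "\<And>i. ((\<lambda>x. g x $ i) has_derivative D i) (at x)"
    using g unfolding differentiable_def by metis
  have c: "((\<lambda>x. f (g x)) has_derivative (\<lambda>h. F (\<chi> i. D i h))) (at x)"
    by (rule has_derivative_compose[OF has_derivative_vec_components[OF D] F])
  then show "(\<lambda>x. f (g x)) differentiable (at x)"
    by (auto simp: differentiable_def)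
  have "F (\<chi> i. D i (axis j 1)) = F (\<Sum>i\<in>UNIV. D i (axis j 1) *\<^sub>R axis i 1)"
    by (rule arg_cong[of _ _ F])
       (simp add: vec_eq_iff axis_def if_distrib[of "\<lambda>x. _ * x"] cong: if_cong)
  also have "\<dots> = (\<Sum>i\<in>UNIV. F (axis i 1) * D i (axis j 1))"
    using has_derivative_linear[OF F] by (simp add: linear_sum linear_cmul mult.commute)
  finally show "partial_deriv j (\<lambda>x. f (g x)) x
      = (\<Sum>i\<in>UNIV. partial_deriv i f (g x) * partial_deriv j (\<lambda>x. g x $ i) x)"
    using partial_deriv_eq[OF c] partial_deriv_eq[OF F] partial_deriv_eq[OF D] by simp
qed

lemma Cdiff_compose:
  fixes f :: "real^'n::finite \<Rightarrow> real" and g :: "real^'n \<Rightarrow> real^'n"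
  shows "Cdiff k f \<Longrightarrow> (\<And>i. Cdiff k (\<lambda>x. g x $ i)) \<Longrightarrow> Cdiff k (\<lambda>x. f (g x))"
proof (induction k arbitrary: f)
  case 0
  then show ?case by (auto intro: partial_deriv_compose(2))
next
  case (Suc k)
  have d: "f differentiable (at x)" "(\<lambda>x. g x $ i) differentiable (at x)" for x i
    using Cdiff_differentiable[OF Suc.prems(1)] Cdiff_differentiable[OF Suc.prems(2)] by auto
  have eq: "partial_deriv j (\<lambda>x. f (g x))
      = (\<lambda>x. \<Sum>i\<in>UNIV. partial_deriv i f (g x) * partial_deriv j (\<lambda>x. g x $ i) x)" for j
    using partial_deriv_compose(1)[OF d] by auto
  have g: "Cdiff k (\<lambda>x. g x $ i)" for i
    by (rule Cdiff_Suc) (rule Suc.prems(2))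
  have "Cdiff k (partial_deriv i f)" for i
    using Suc.prems(1) by simp
  then have "Cdiff k (\<lambda>x. partial_deriv i f (g x))" for i
    using g by (rule Suc.IH)
  moreover have "Cdiff k (partial_deriv j (\<lambda>x. g x $ i))" for i j
    using Suc.prems(2)[of i] by simp
  ultimately show ?case
    using partial_deriv_compose(2)[OF d] by (auto simp: eq intro!: Cdiff_sum Cdiff_mult)
qed

lemma smooth_map_compose: "smooth_map \<phi> \<Longrightarrow> smooth_map \<psi> \<Longrightarrow> smooth_map (\<phi> \<circ> \<psi>)"
  unfolding smooth_map_def smooth_iff_Cdiff
  using Cdiff_compose[of _ "\<lambda>x. \<phi> x $ _" \<psi>] by auto

lemma smooth_map_linear:
  assumes "linear (\<psi> :: real^'n::finite \<Rightarrow> real^'n)"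
  shows "smooth_map \<psi>"
proof -
  have "linear (\<lambda>x. \<psi> x $ i)" for i
    using assms by (intro linearI) (auto simp: linear_add linear_cmul)
  then show ?thesis
    by (auto simp: smooth_map_def smooth_iff_Cdiff Cdiff_linear)
qed

lemma smooth_map_has_derivative:
  assumes "smooth_map \<psi>"
  shows "(\<psi> has_derivative (\<lambda>h. jacobian \<psi> (at x) *v h)) (at x)"
proof -
  have "\<forall>i. \<exists>D. ((\<lambda>x. \<psi> x $ i) has_derivative D) (at x)"
    using assms smooth_differentiable unfolding smooth_map_def differentiable_def by blast
  then obtain D where "\<And>i. ((\<lambda>x. \<psi> x $ i) has_derivative D i) (at x)"
    by metis
  then show ?thesis
    using has_derivative_vec_components jacobian_works differentiable_def by blast
qed

lemma jacobian_eq: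
  fixes \<psi> :: "real^'n::finite \<Rightarrow> real^'n"
  assumes "(\<psi> has_derivative (\<lambda>h. A *v h)) (at x)"
  shows "jacobian \<psi> (at x) = A"
  unfolding jacobian_def using frechet_derivative_at[OF assms] by (metis matrix_of_matrix_vector_mul)

lemma jacobian_compose:
  assumes "smooth_map \<phi>" "smooth_map \<psi>"
  shows "jacobian (\<phi> \<circ> \<psi>) (at x) = jacobian \<phi> (at (\<psi> x)) ** jacobian \<psi> (at x)"
  using diff_chain_at[OF smooth_map_has_derivative[OF assms(2)] smooth_map_has_derivative[OF assms(1)]]
  by (intro jacobian_eq) (simp add: o_def matrix_vector_mul_assoc)

lemma jacobian_matrix: "jacobian (\<lambda>x. A *v x) (at x) = (A :: real^'n^'n::finite)"
  by (rule jacobian_eq) (rule bounded_linear_imp_has_derivative, simp)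

lemma jacobian_id: "jacobian (id :: real^'n \<Rightarrow> real^'n::finite) (at x) = mat 1"
  by (rule jacobian_eq) (simp add: id_def)

lemma orientation_preserving_diffeo_compose:
  assumes "orientation_preserving_diffeo \<phi>" "orientation_preserving_diffeo \<psi>"
  shows "orientation_preserving_diffeo (\<phi> \<circ> \<psi>)"
  using assms unfolding orientation_preserving_diffeo_def
  by (auto simp: bij_comp smooth_map_compose o_inv_distrib jacobian_compose det_mul)

lemma jacobian_inv:
  assumes "orientation_preserving_diffeo \<psi>"
  shows "jacobian \<psi> (at (inv \<psi> x)) ** jacobian (inv \<psi>) (at x) = mat 1"
proof -
  have "\<psi> \<circ> inv \<psi> = id"
    using assms by (auto simp: orientation_preserving_diffeo_def bij_def surj_f_inv_f fun_eq_iff)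
  then show ?thesis
    using assms jacobian_compose[of \<psi> "inv \<psi>" x] jacobian_id[of x]
    by (simp add: orientation_preserving_diffeo_def)
qed

lemma orientation_preserving_diffeo_inv:
  assumes "orientation_preserving_diffeo \<psi>"
  shows "orientation_preserving_diffeo (inv \<psi>)"
proof -
  have "det (jacobian (inv \<psi>) (at x)) > 0" for x
  proof -
    have "det (jacobian \<psi> (at (inv \<psi> x))) * det (jacobian (inv \<psi>) (at x)) = 1"
      using jacobian_inv[OF assms, of x] by (metis det_I det_mul)
    moreover have "det (jacobian \<psi> (at (inv \<psi> x))) > 0"
      using assms by (simp add: orientation_preserving_diffeo_def)
    ultimately show ?thesis
      by (metis zero_less_mult_pos zero_less_one)
  qed
  then show ?thesis
    using assms by (auto simp: orientation_preserving_diffeo_def bij_imp_bij_inv inv_inv_eq)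
qed

lemma orientation_preserving_diffeo_id: "orientation_preserving_diffeo id"
  using smooth_map_linear[OF linear_id] by (auto simp: orientation_preserving_diffeo_def jacobian_id)

text \<open>The groups \<open>G\<dagger>\<close>, \<open>G\<dagger>\<^sub>0\<close> and \<open>N\<close> become types below, so that functions on them are total
  functions. The dimension is the cardinality of the index type \<open>'n\<close>.\<close>

definition diff_set :: "(real^'n::finite \<Rightarrow> real^'n) set" where
  "diff_set = {\<psi>. orientation_preserving_diffeo \<psi> \<and> \<psi> 0 = 0}"

definition lin_set :: "(real^'n::finite \<Rightarrow> real^'n) set" where
  "lin_set = {\<psi> \<in> diff_set. \<exists>a. \<psi> = (\<lambda>x. a *v x)}"

definition nil_set :: "(real^'n::finite \<Rightarrow> real^'n) set" where
  "nil_set = {\<psi> \<in> diff_set. jacobian \<psi> (at 0) = mat 1}"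

lemma diff_set_id: "id \<in> diff_set"
  by (simp add: diff_set_def orientation_preserving_diffeo_id)

lemma diff_set_compose: "\<phi> \<in> diff_set \<Longrightarrow> \<psi> \<in> diff_set \<Longrightarrow> \<phi> \<circ> \<psi> \<in> diff_set"
  by (simp add: diff_set_def orientation_preserving_diffeo_compose)

lemma diff_set_inv0: "\<psi> \<in> diff_set \<Longrightarrow> inv \<psi> 0 = 0"
  by (auto simp: diff_set_def orientation_preserving_diffeo_def bij_def) (metis inv_f_f)

lemma diff_set_inv: "\<psi> \<in> diff_set \<Longrightarrow> inv \<psi> \<in> diff_set"
  using diff_set_inv0 by (auto simp: diff_set_def orientation_preserving_diffeo_inv)

lemma diff_set_jacobian_compose:
  "\<phi> \<in> diff_set \<Longrightarrow> \<psi> \<in> diff_set \<Longrightarrow>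
    jacobian (\<phi> \<circ> \<psi>) (at 0) = jacobian \<phi> (at 0) ** jacobian \<psi> (at 0)"
  by (simp add: diff_set_def orientation_preserving_diffeo_def jacobian_compose)

lemma diff_set_jacobian_inv:
  assumes "\<psi> \<in> diff_set"
  shows "jacobian \<psi> (at 0) ** jacobian (inv \<psi>) (at 0) = mat 1"
    and "jacobian (inv \<psi>) (at 0) ** jacobian \<psi> (at 0) = mat 1"
proof -
  show "jacobian \<psi> (at 0) ** jacobian (inv \<psi>) (at 0) = mat 1"
    using assms jacobian_inv[of \<psi> 0] diff_set_inv0[OF assms] by (simp add: diff_set_def)
  then show "jacobian (inv \<psi>) (at 0) ** jacobian \<psi> (at 0) = mat 1"
    by (simp add: matrix_left_right_inverse)
qed

lemma lin_set_id: "id \<in> lin_set"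
  using diff_set_id by (auto simp: lin_set_def fun_eq_iff intro!: exI[of _ "mat 1"])

lemma lin_set_compose: "\<phi> \<in> lin_set \<Longrightarrow> \<psi> \<in> lin_set \<Longrightarrow> \<phi> \<circ> \<psi> \<in> lin_set"
  using diff_set_compose by (auto simp: lin_set_def o_def matrix_vector_mul_assoc)

lemma lin_set_inv:
  assumes "\<psi> \<in> lin_set"
  shows "inv \<psi> \<in> lin_set"
proof -
  obtain a where a: "\<psi> = (\<lambda>x. a *v x)" and d: "\<psi> \<in> diff_set"
    using assms by (auto simp: lin_set_def)
  have b: "bij \<psi>"
    using d by (simp add: diff_set_def orientation_preserving_diffeo_def)
  have "linear (inv \<psi>)"
  proof (rule linearI)
    have s: "\<psi> (inv \<psi> z) = z" for z
      using b by (simp add: bij_def surj_f_inv_f)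
    have i: "inv \<psi> w = z" if "w = \<psi> z" for w z
      using b that by (simp add: bij_def)
    show "inv \<psi> (x + y) = inv \<psi> x + inv \<psi> y" for x y
      by (rule i) (metis a s matrix_vector_right_distrib)
    show "inv \<psi> (c *\<^sub>R x) = c *\<^sub>R inv \<psi> x" for c x
      by (rule i) (metis a s matrix_vector_mult_scaleR)
  qed
  then have "inv \<psi> = (\<lambda>x. matrix (inv \<psi>) *v x)"
    by (simp add: matrix_works fun_eq_iff)
  then show ?thesis
    using diff_set_inv[OF d] by (auto simp: lin_set_def)
qed

lemma nil_set_id: "id \<in> nil_set"
  by (simp add: nil_set_def diff_set_id jacobian_id)

lemma nil_set_compose: "\<phi> \<in> nil_set \<Longrightarrow> \<psi> \<in> nil_set \<Longrightarrow> \<phi> \<circ> \<psi> \<in> nil_set"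
  by (auto simp: nil_set_def diff_set_compose diff_set_jacobian_compose)

lemma nil_set_inv: "\<psi> \<in> nil_set \<Longrightarrow> inv \<psi> \<in> nil_set"
  using diff_set_jacobian_inv(1)[of \<psi>] by (auto simp: nil_set_def diff_set_inv)

lemma nil_set_conj:
  assumes "\<nu> \<in> nil_set" "l \<in> lin_set"
  shows "inv l \<circ> \<nu> \<circ> l \<in> nil_set"
  using assms
  by (auto simp: nil_set_def lin_set_def diff_set_compose diff_set_inv diff_set_jacobian_compose
      diff_set_jacobian_inv)

typedef ('n::finite) diff_grp = "diff_set :: (real^'n \<Rightarrow> real^'n) set"
  morphisms diff_map Abs_diff by (rule exI, rule diff_set_id)

typedef ('n::finite) lin_grp = "lin_set :: (real^'n \<Rightarrow> real^'n) set"
  morphisms lin_map Abs_lin by (rule exI, rule lin_set_id)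

typedef ('n::finite) nil_grp = "nil_set :: (real^'n \<Rightarrow> real^'n) set"
  morphisms nil_map Abs_nil by (rule exI, rule nil_set_id)

setup_lifting type_definition_diff_grp
setup_lifting type_definition_lin_grp
setup_lifting type_definition_nil_grp

lift_definition diff_mult :: "'n::finite diff_grp \<Rightarrow> 'n diff_grp \<Rightarrow> 'n diff_grp"
  is "\<lambda>\<phi> \<psi>. \<phi> \<circ> \<psi>" by (rule diff_set_compose)
lift_definition diff_one :: "'n::finite diff_grp" is id by (rule diff_set_id)
lift_definition diff_inv :: "'n::finite diff_grp \<Rightarrow> 'n diff_grp" is "\<lambda>\<psi>. inv \<psi>" by (rule diff_set_inv)

lift_definition lin_mult :: "'n::finite lin_grp \<Rightarrow> 'n lin_grp \<Rightarrow> 'n lin_grp"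
  is "\<lambda>\<phi> \<psi>. \<phi> \<circ> \<psi>" by (rule lin_set_compose)
lift_definition lin_one :: "'n::finite lin_grp" is id by (rule lin_set_id)
lift_definition lin_inv :: "'n::finite lin_grp \<Rightarrow> 'n lin_grp" is "\<lambda>\<psi>. inv \<psi>" by (rule lin_set_inv)

lift_definition nil_mult :: "'n::finite nil_grp \<Rightarrow> 'n nil_grp \<Rightarrow> 'n nil_grp"
  is "\<lambda>\<phi> \<psi>. \<phi> \<circ> \<psi>" by (rule nil_set_compose)
lift_definition nil_one :: "'n::finite nil_grp" is id by (rule nil_set_id)
lift_definition nil_inv :: "'n::finite nil_grp \<Rightarrow> 'n nil_grp" is "\<lambda>\<psi>. inv \<psi>" by (rule nil_set_inv)

lift_definition nil_act :: "'n::finite nil_grp \<Rightarrow> 'n lin_grp \<Rightarrow> 'n nil_grp"  (infixl "\<triangleleft>" 70)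
  is "\<lambda>\<nu> l. inv l \<circ> \<nu> \<circ> l" by (rule nil_set_conj)

lift_definition lin_nil_comp :: "'n::finite lin_grp \<Rightarrow> 'n nil_grp \<Rightarrow> 'n diff_grp"
  is "\<lambda>l \<nu>. l \<circ> \<nu>" by (auto simp: lin_set_def nil_set_def diff_set_compose)

text \<open>The ground field is any field extension of the reals, in particular the real or the complex
  numbers.\<close>

inductive_set generated_algebra :: "('x \<Rightarrow> 'k::real_field) set \<Rightarrow> ('x \<Rightarrow> 'k) set"
  for B :: "('x \<Rightarrow> 'k) set" where
  gen: "f \<in> B \<Longrightarrow> f \<in> generated_algebra B"
| const: "(\<lambda>_. c) \<in> generated_algebra B"
| add: "f \<in> generated_algebra B \<Longrightarrow> g \<in> generated_algebra B \<Longrightarrow> (\<lambda>x. f x + g x) \<in> generated_algebra B"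
| mult: "f \<in> generated_algebra B \<Longrightarrow> g \<in> generated_algebra B \<Longrightarrow> (\<lambda>x. f x * g x) \<in> generated_algebra B"

definition function_subspace :: "('x \<Rightarrow> 'k::field) set \<Rightarrow> bool" where
  "function_subspace A \<longleftrightarrow> (\<lambda>_. 0) \<in> A \<and> (\<forall>f\<in>A. \<forall>g\<in>A. (\<lambda>x. f x + g x) \<in> A) \<and>
     (\<forall>c. \<forall>f\<in>A. (\<lambda>x. c * f x) \<in> A)"

definition function_algebra :: "('x \<Rightarrow> 'k::field) set \<Rightarrow> bool" where
  "function_algebra A \<longleftrightarrow> function_subspace A \<and> (\<lambda>_. 1) \<in> A \<and> (\<forall>f\<in>A. \<forall>g\<in>A. (\<lambda>x. f x * g x) \<in> A)"

definition linear_on_functions ::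
    "('x \<Rightarrow> 'k::field) set \<Rightarrow> (('x \<Rightarrow> 'k) \<Rightarrow> ('y \<Rightarrow> 'k)) \<Rightarrow> bool" where
  "linear_on_functions A T \<longleftrightarrow>
     (\<forall>f\<in>A. \<forall>g\<in>A. T (\<lambda>x. f x + g x) = (\<lambda>y. T f y + T g y)) \<and>
     (\<forall>c. \<forall>f\<in>A. T (\<lambda>x. c * f x) = (\<lambda>y. c * T f y))"

definition algebra_hom_on ::
    "('x \<Rightarrow> 'k::field) set \<Rightarrow> (('x \<Rightarrow> 'k) \<Rightarrow> ('y \<Rightarrow> 'k)) \<Rightarrow> bool" where
  "algebra_hom_on A T \<longleftrightarrow> linear_on_functions A T \<and> T (\<lambda>_. 1) = (\<lambda>_. 1) \<and>
     (\<forall>f\<in>A. \<forall>g\<in>A. T (\<lambda>x. f x * g x) = (\<lambda>y. T f y * T g y))"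

text \<open>The tensor product of two spaces of functions, realised as a space of functions on the
  product: \<open>f \<otimes> g\<close> is the function \<open>(x, y) \<mapsto> f x * g y\<close>. By \<open>function_tensor_universal\<close> below, every
  bilinear map factors through it (uniquely, as it is spanned by the \<open>f \<otimes> g\<close>), so this is the
  algebraic tensor product over the ground field.\<close>

definition function_tensor ::
    "('x \<Rightarrow> 'k::field) set \<Rightarrow> ('y \<Rightarrow> 'k) set \<Rightarrow> ('x \<times> 'y \<Rightarrow> 'k) set"  (infixr "\<otimes>\<^sub>f" 75) where
  "A \<otimes>\<^sub>f B = {\<lambda>(x, y). \<Sum>i<m. f i x * g i y | (m::nat) f g. (\<forall>i<m. f i \<in> A \<and> g i \<in> B)}"

lemma function_subspace_add: "function_subspace A \<Longrightarrow> f \<in> A \<Longrightarrow> g \<in> A \<Longrightarrow> (\<lambda>x. f x + g x) \<in> A"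
  by (simp add: function_subspace_def)

lemma function_subspace_scale: "function_subspace A \<Longrightarrow> f \<in> A \<Longrightarrow> (\<lambda>x. c * f x) \<in> A"
  by (simp add: function_subspace_def)

lemma function_tensor_zero:
  fixes bl :: "('x \<Rightarrow> 'k::field) \<Rightarrow> ('y \<Rightarrow> 'k) \<Rightarrow> 'v::ab_group_add" and scale :: "'k \<Rightarrow> 'v \<Rightarrow> 'v" and m :: nat
  assumes V: "vector_space scale" and A: "function_subspace A" and B: "function_subspace B"
    and add1: "\<And>a a' b. a \<in> A \<Longrightarrow> a' \<in> A \<Longrightarrow> b \<in> B \<Longrightarrow> bl (\<lambda>x. a x + a' x) b = bl a b + bl a' b"
    and add2: "\<And>a b b'. a \<in> A \<Longrightarrow> b \<in> B \<Longrightarrow> b' \<in> B \<Longrightarrow> bl a (\<lambda>y. b y + b' y) = bl a b + bl a b'"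
    and sc1: "\<And>c a b. a \<in> A \<Longrightarrow> b \<in> B \<Longrightarrow> bl (\<lambda>x. c * a x) b = scale c (bl a b)"
    and sc2: "\<And>c a b. a \<in> A \<Longrightarrow> b \<in> B \<Longrightarrow> bl a (\<lambda>y. c * b y) = scale c (bl a b)"
  shows "(\<forall>i<m. f i \<in> A \<and> g i \<in> B) \<Longrightarrow> (\<And>x y. (\<Sum>i<m. f i x * g i y) = 0) \<Longrightarrow>
    (\<Sum>i<m. bl (f i) (g i)) = 0"
proof (induction m arbitrary: f g)
  case 0
  then show ?case by simp
next
  case (Suc m)
  interpret V: vector_space scale by (rule V)
  have fA: "f i \<in> A" and gB: "g i \<in> B" if "i \<le> m" for i
    using Suc.prems that by auto
  show ?case
  proof (cases "\<exists>y. g m y \<noteq> 0")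
    case False
    then have g0: "g m = (\<lambda>y. 0)" by auto
    have "bl (f m) (g m) = 0"
      using sc2[OF fA gB, of m m 0] by (simp add: g0)
    moreover have "(\<Sum>i<m. bl (f i) (g i)) = 0"
      using Suc.prems False by (intro Suc.IH) auto
    ultimately show ?thesis by simp
  next
    case True
    then obtain y0 where y0: "g m y0 \<noteq> 0" by blast
    define c where "c i = - (g i y0 / g m y0)" for i
    have fm: "f m x = (\<Sum>i<m. c i * f i x)" for x
    proof -
      have "(\<Sum>i<m. f i x * g i y0) + f m x * g m y0 = 0"
        using Suc.prems(2)[of x y0] by simp
      then have "f m x * g m y0 = - (\<Sum>i<m. f i x * g i y0)"
        by (simp add: eq_neg_iff_add_eq_0 add.commute)
      then have "f m x = - (\<Sum>i<m. f i x * g i y0) / g m y0"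
        using y0 by (metis nonzero_mult_div_cancel_right)
      then show ?thesis
        by (simp add: c_def sum_divide_distrib sum_negf mult.commute)
    qed
    have sumA: "(\<lambda>x. \<Sum>i<l. c i * f i x) \<in> A \<and>
        bl (\<lambda>x. \<Sum>i<l. c i * f i x) (g m) = (\<Sum>i<l. scale (c i) (bl (f i) (g m)))"
      if "l \<le> m" for l
      using that
    proof (induction l)
      case 0
      have z: "(\<lambda>x. 0) \<in> A" using A by (simp add: function_subspace_def)
      have "bl (\<lambda>x. 0) (g m) = 0"
        using sc1[OF z gB[of m], of 0] by simp
      then show ?case using z by simp
    next
      case (Suc l)
      have "(\<lambda>x. c l * f l x) \<in> A"
        using Suc.prems by (intro function_subspace_scale[OF A] fA) simp
      moreover from this have "(\<lambda>x. (\<Sum>i<l. c i * f i x) + c l * f l x) \<in> A"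
        using Suc by (intro function_subspace_add[OF A]) auto
      ultimately show ?case
        using Suc add1[of "\<lambda>x. \<Sum>i<l. c i * f i x" "\<lambda>x. c l * f l x" "g m"]
          sc1[OF fA[of l] gB[of m], of "c l"] gB[of m] by simp
    qed
    have bm: "bl (f m) (g m) = (\<Sum>i<m. scale (c i) (bl (f i) (g m)))"
    proof -
      have "f m = (\<lambda>x. \<Sum>i<m. c i * f i x)" using fm by blast
      then show ?thesis using sumA[of m] by (metis order_refl)
    qed
    define h where "h i = (\<lambda>y. g i y + c i * g m y)" for i
    have cB: "(\<lambda>y. c i * g m y) \<in> B" for i
      by (intro function_subspace_scale[OF B] gB) simp
    have hB: "h i \<in> B" if "i < m" for i
      using that unfolding h_def by (intro function_subspace_add[OF B] gB cB) simp
    have "(\<Sum>i<m. bl (f i) (h i)) = 0"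
    proof (rule Suc.IH)
      show "\<forall>i<m. f i \<in> A \<and> h i \<in> B" using hB fA by auto
      show "(\<Sum>i<m. f i x * h i y) = 0" for x y
      proof -
        have "(\<Sum>i<m. f i x * h i y) = (\<Sum>i<m. f i x * g i y) + (\<Sum>i<m. c i * f i x) * g m y"
          by (simp add: h_def algebra_simps sum.distrib sum_distrib_left sum_negf sum_subtractf)
        also have "\<dots> = (\<Sum>i<Suc m. f i x * g i y)"
          by (simp add: fm)
        finally show ?thesis using Suc.prems(2) by simp
      qed
    qed
    moreover have "bl (f i) (h i) = bl (f i) (g i) + scale (c i) (bl (f i) (g m))" if "i < m" for i
      unfolding h_def using that add2[OF fA gB cB, of i i i] sc2[OF fA gB, of i m] by simp
    ultimately show ?thesis
      by (simp add: bm sum.distrib)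
  qed
qed

theorem function_tensor_universal:
  fixes bl :: "('x \<Rightarrow> 'k::field) \<Rightarrow> ('y \<Rightarrow> 'k) \<Rightarrow> 'v::ab_group_add" and scale :: "'k \<Rightarrow> 'v \<Rightarrow> 'v"
  assumes V: "vector_space scale" and A: "function_subspace A" and B: "function_subspace B"
    and add1: "\<And>a a' b. a \<in> A \<Longrightarrow> a' \<in> A \<Longrightarrow> b \<in> B \<Longrightarrow> bl (\<lambda>x. a x + a' x) b = bl a b + bl a' b"
    and add2: "\<And>a b b'. a \<in> A \<Longrightarrow> b \<in> B \<Longrightarrow> b' \<in> B \<Longrightarrow> bl a (\<lambda>y. b y + b' y) = bl a b + bl a b'"
    and sc1: "\<And>c a b. a \<in> A \<Longrightarrow> b \<in> B \<Longrightarrow> bl (\<lambda>x. c * a x) b = scale c (bl a b)"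
    and sc2: "\<And>c a b. a \<in> A \<Longrightarrow> b \<in> B \<Longrightarrow> bl a (\<lambda>y. c * b y) = scale c (bl a b)"
  shows "\<exists>L. \<forall>(m::nat) f g. (\<forall>i<m. f i \<in> A \<and> g i \<in> B) \<longrightarrow>
    L (\<lambda>(x, y). \<Sum>i<m. f i x * g i y) = (\<Sum>i<m. bl (f i) (g i))"
proof -
  interpret V: vector_space scale by (rule V)
  define R where "R F v \<longleftrightarrow> (\<exists>(m::nat) f g. (\<forall>i<m. f i \<in> A \<and> g i \<in> B) \<and>
    F = (\<lambda>(x, y). \<Sum>i<m. f i x * g i y) \<and> v = (\<Sum>i<m. bl (f i) (g i)))" for F v
  have R_unique: "v = w" if R: "R F v" "R F w" for F v w
  proof -
    obtain m :: nat and f g where 1: "\<And>i. i < m \<Longrightarrow> f i \<in> A \<and> g i \<in> B"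
      "F = (\<lambda>(x, y). \<Sum>i<m. f i x * g i y)" "v = (\<Sum>i<m. bl (f i) (g i))"
      using R(1) unfolding R_def by blast
    obtain l :: nat and p q where 2: "\<And>i. i < l \<Longrightarrow> p i \<in> A \<and> q i \<in> B"
      "F = (\<lambda>(x, y). \<Sum>i<l. p i x * q i y)" "w = (\<Sum>i<l. bl (p i) (q i))"
      using R(2) unfolding R_def by blast
    define f' where "f' i = (if i < m then f i else (\<lambda>x. - p (i - m) x))" for i
    define g' where "g' i = (if i < m then g i else q (i - m))" for i
    have split: "(\<Sum>i<m+l. H i) = (\<Sum>i<m. H i) + (\<Sum>i<l. H (m + i))" for H :: "nat \<Rightarrow> 'b::ab_group_add"
      by (induction l) (auto simp: algebra_simps)
    have "(\<Sum>i<m+l. bl (f' i) (g' i)) = 0"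
    proof (rule function_tensor_zero[OF V A B add1 add2 sc1 sc2])
      show "\<forall>i<m+l. f' i \<in> A \<and> g' i \<in> B"
      proof (intro allI impI)
        fix i assume "i < m + l"
        then have "i < m \<or> i - m < l" by auto
        then show "f' i \<in> A \<and> g' i \<in> B"
          using 1(1)[of i] 2(1)[of "i - m"] function_subspace_scale[OF A, of "p (i - m)" "- 1"]
            \<open>i < m + l\<close>
          by (auto simp: f'_def g'_def)
      qed
      show "(\<Sum>i<m+l. f' i x * g' i y) = 0" for x y
        using fun_cong[OF trans[OF 1(2)[symmetric] 2(2)], of "(x, y)"]
        by (simp add: split f'_def g'_def sum_negf)
    qed
    moreover have "bl (\<lambda>x. - p i x) (q i) = - bl (p i) (q i)" if "i < l" for i
      using sc1[of "p i" "q i" "- 1"] 2(1)[OF that] by simp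
    ultimately show "v = w"
      by (simp add: split f'_def g'_def 1 2 sum_negf)
  qed
  show ?thesis
  proof (intro exI[of _ "\<lambda>F. THE v. R F v"] allI impI)
    fix m :: nat and f g
    assume "\<forall>i<m. f i \<in> A \<and> g i \<in> B"
    then have "R (\<lambda>(x, y). \<Sum>i<m. f i x * g i y) (\<Sum>i<m. bl (f i) (g i))"
      unfolding R_def by blast
    then show "(THE v. R (\<lambda>(x, y). \<Sum>i<m. f i x * g i y) v) = (\<Sum>i<m. bl (f i) (g i))"
      using R_unique by blast
  qed
qed

text \<open>The tensor product \<open>T \<otimes> S\<close> of two linear maps: it applies \<open>S\<close> in the second variable and
  \<open>T\<close> in the first one. On \<open>\<Sum>i. f i \<otimes> g i\<close> this gives \<open>\<Sum>i. T (f i) \<otimes> S (g i)\<close>; see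
  \<open>tensor_map_sum\<close>.\<close>

definition tensor_map ::
    "(('x \<Rightarrow> 'k) \<Rightarrow> ('u \<Rightarrow> 'k)) \<Rightarrow> (('y \<Rightarrow> 'k) \<Rightarrow> ('v \<Rightarrow> 'k)) \<Rightarrow>
     ('x \<times> 'y \<Rightarrow> 'k) \<Rightarrow> ('u \<times> 'v \<Rightarrow> 'k)" where
  "tensor_map T S F = (\<lambda>(u, v). T (\<lambda>x. S (\<lambda>y. F (x, y)) v) u)"

lemma linear_on_functions_add:
  "linear_on_functions A T \<Longrightarrow> f \<in> A \<Longrightarrow> g \<in> A \<Longrightarrow> T (\<lambda>x. f x + g x) = (\<lambda>y. T f y + T g y)"
  by (simp add: linear_on_functions_def)

lemma linear_on_functions_scale:
  "linear_on_functions A T \<Longrightarrow> f \<in> A \<Longrightarrow> T (\<lambda>x. c * f x) = (\<lambda>y. c * T f y)"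
  by (simp add: linear_on_functions_def)

lemma linear_on_functions_sum:
  fixes m :: nat
  assumes A: "function_subspace A" and T: "linear_on_functions A T"
  shows "(\<forall>i<m. f i \<in> A) \<Longrightarrow> (\<lambda>x. \<Sum>i<m. c i * f i x) \<in> A \<and>
    T (\<lambda>x. \<Sum>i<m. c i * f i x) = (\<lambda>u. \<Sum>i<m. c i * T (f i) u)"
proof (induction m)
  case 0
  have z: "(\<lambda>x. 0) \<in> A" using A by (simp add: function_subspace_def)
  then show ?case using linear_on_functions_scale[OF T z, of 0] by simp
next
  case (Suc m)
  then have 1: "f m \<in> A" and 2: "(\<lambda>x. \<Sum>i<m. c i * f i x) \<in> A"
    and 3: "T (\<lambda>x. \<Sum>i<m. c i * f i x) = (\<lambda>u. \<Sum>i<m. c i * T (f i) u)"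
    by auto
  have 4: "(\<lambda>x. c m * f m x) \<in> A"
    by (rule function_subspace_scale[OF A 1])
  show ?case
    using function_subspace_add[OF A 2 4] linear_on_functions_add[OF T 2 4]
      linear_on_functions_scale[OF T 1, of "c m"] 3 by simp
qed

lemma tensor_map_sum:
  fixes m :: nat
  assumes A: "function_subspace A" "linear_on_functions A T"
    and B: "function_subspace B" "linear_on_functions B S"
    and fg: "\<forall>i<m. f i \<in> A \<and> g i \<in> B"
  shows "tensor_map T S (\<lambda>(x, y). \<Sum>i<m. f i x * g i y) = (\<lambda>(u, v). \<Sum>i<m. T (f i) u * S (g i) v)"
proof -
  have "S (\<lambda>y. \<Sum>i<m. f i x * g i y) v = (\<Sum>i<m. S (g i) v * f i x)" for x v
    using linear_on_functions_sum[OF B, of m g "\<lambda>i. f i x"] fg by (simp add: mult.commute)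
  moreover have "T (\<lambda>x. \<Sum>i<m. S (g i) v * f i x) u = (\<Sum>i<m. T (f i) u * S (g i) v)" for u v
    using linear_on_functions_sum[OF A, of m f "\<lambda>i. S (g i) v"] fg by (simp add: mult.commute)
  ultimately show ?thesis
    by (simp add: tensor_map_def)
qed

text \<open>A Hopf algebra whose underlying algebra is an algebra of functions on a set; multiplication
  and unit are pointwise.\<close>

record ('x, 'k) hopf =
  hcarrier :: "('x \<Rightarrow> 'k) set"
  comult :: "('x \<Rightarrow> 'k) \<Rightarrow> ('x \<times> 'x \<Rightarrow> 'k)"
  counit :: "('x \<Rightarrow> 'k) \<Rightarrow> 'k"
  antipode :: "('x \<Rightarrow> 'k) \<Rightarrow> ('x \<Rightarrow> 'k)"

text \<open>The counit is scalar-valued; to say that it is an algebra homomorphism it is viewed as taking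
  values in the functions on a one-point set.\<close>

definition bialgebra ::
    "('x \<Rightarrow> 'k::field) set \<Rightarrow> (('x \<Rightarrow> 'k) \<Rightarrow> ('x \<times> 'x \<Rightarrow> 'k)) \<Rightarrow> (('x \<Rightarrow> 'k) \<Rightarrow> 'k) \<Rightarrow> bool" where
  "bialgebra A \<Delta> \<epsilon> \<longleftrightarrow>
     function_algebra A \<and>
     \<Delta> ` A \<subseteq> A \<otimes>\<^sub>f A \<and> algebra_hom_on A \<Delta> \<and> algebra_hom_on A (\<lambda>f (_::unit). \<epsilon> f) \<and>
     (\<forall>f\<in>A. \<forall>x y z. tensor_map \<Delta> id (\<Delta> f) ((x, y), z) = tensor_map id \<Delta> (\<Delta> f) (x, (y, z))) \<and>
     (\<forall>f\<in>A. \<forall>x. \<epsilon> (\<lambda>y. \<Delta> f (y, x)) = f x \<and> \<epsilon> (\<lambda>y. \<Delta> f (x, y)) = f x)"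

text \<open>Multiplication \<open>A \<otimes> A \<rightarrow> A\<close> is restriction to the diagonal.\<close>

definition is_antipode ::
    "('x \<Rightarrow> 'k::field) set \<Rightarrow> (('x \<Rightarrow> 'k) \<Rightarrow> ('x \<times> 'x \<Rightarrow> 'k)) \<Rightarrow> (('x \<Rightarrow> 'k) \<Rightarrow> 'k) \<Rightarrow>
     (('x \<Rightarrow> 'k) \<Rightarrow> ('x \<Rightarrow> 'k)) \<Rightarrow> bool" where
  "is_antipode A \<Delta> \<epsilon> S \<longleftrightarrow>
     S ` A \<subseteq> A \<and> linear_on_functions A S \<and>
     (\<forall>f\<in>A. \<forall>x. tensor_map S id (\<Delta> f) (x, x) = \<epsilon> f \<and> tensor_map id S (\<Delta> f) (x, x) = \<epsilon> f)"

definition hopf_algebra :: "('x, 'k::field) hopf \<Rightarrow> bool" where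
  "hopf_algebra H \<longleftrightarrow> bialgebra (hcarrier H) (comult H) (counit H) \<and>
     is_antipode (hcarrier H) (comult H) (counit H) (antipode H)"

definition hopf_hom ::
    "('x, 'k::field) hopf \<Rightarrow> ('y, 'k) hopf \<Rightarrow> (('x \<Rightarrow> 'k) \<Rightarrow> ('y \<Rightarrow> 'k)) \<Rightarrow> bool" where
  "hopf_hom H K \<Phi> \<longleftrightarrow>
     \<Phi> ` hcarrier H \<subseteq> hcarrier K \<and> algebra_hom_on (hcarrier H) \<Phi> \<and>
     (\<forall>f\<in>hcarrier H. tensor_map \<Phi> \<Phi> (comult H f) = comult K (\<Phi> f)) \<and>
     (\<forall>f\<in>hcarrier H. counit K (\<Phi> f) = counit H f) \<and>
     (\<forall>f\<in>hcarrier H. \<Phi> (antipode H f) = antipode K (\<Phi> f))"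

definition hopf_iso ::
    "('x, 'k::field) hopf \<Rightarrow> ('y, 'k) hopf \<Rightarrow> (('x \<Rightarrow> 'k) \<Rightarrow> ('y \<Rightarrow> 'k)) \<Rightarrow> bool" where
  "hopf_iso H K \<Phi> \<longleftrightarrow> hopf_algebra H \<and> hopf_algebra K \<and> hopf_hom H K \<Phi> \<and>
     bij_betw \<Phi> (hcarrier H) (hcarrier K)"

definition group_function_hopf ::
    "('x \<Rightarrow> 'k::field) set \<Rightarrow> ('x \<Rightarrow> 'x \<Rightarrow> 'x) \<Rightarrow> 'x \<Rightarrow> ('x \<Rightarrow> 'x) \<Rightarrow> ('x, 'k) hopf" where
  "group_function_hopf A mul e iv =
     \<lparr>hcarrier = A, comult = (\<lambda>f (x, y). f (mul x y)), counit = (\<lambda>f. f e),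
      antipode = (\<lambda>f x. f (iv x))\<rparr>"

text \<open>The coproduct of a bicrossed product, where \<open>\<rho> f = f\<langle>0\<rangle> \<otimes> f\<langle>1\<rangle>\<close>. It is the composition of
  \<open>\<Delta>A \<otimes> ((\<rho> \<otimes> id) \<circ> \<Delta>B)\<close>, which sends \<open>f1 \<otimes> f2\<close> to
  \<open>(f1(1) \<otimes> f1(2)) \<otimes> ((f2(1)\<langle>0\<rangle> \<otimes> f2(1)\<langle>1\<rangle>) \<otimes> f2(2))\<close>, with the permutation of the factors and the
  multiplication of \<open>f1(2)\<close> and \<open>f2(1)\<langle>1\<rangle>\<close>, i.e. the identification of their variables.\<close>

definition bicrossed_comult ::
    "(('x \<Rightarrow> 'k) \<Rightarrow> ('x \<times> 'x \<Rightarrow> 'k)) \<Rightarrow> (('y \<Rightarrow> 'k) \<Rightarrow> ('y \<times> 'y \<Rightarrow> 'k)) \<Rightarrow>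
     (('y \<Rightarrow> 'k) \<Rightarrow> ('y \<times> 'x \<Rightarrow> 'k)) \<Rightarrow> ('x \<times> 'y \<Rightarrow> 'k) \<Rightarrow> (('x \<times> 'y) \<times> ('x \<times> 'y) \<Rightarrow> 'k)" where
  "bicrossed_comult \<Delta>A \<Delta>B \<rho> F = (\<lambda>((x1, y1), (x2, y2)).
     tensor_map \<Delta>A (\<lambda>g. tensor_map \<rho> id (\<Delta>B g)) F ((x1, x2), ((y1, x2), y2)))"

lemma bicrossed_comult_sweedler:
  fixes I J :: nat and K :: "nat \<Rightarrow> nat"
  assumes A: "function_subspace A" "linear_on_functions A \<Delta>A" "f1 \<in> A"
    and B: "function_subspace B" "linear_on_functions B \<Delta>B" "linear_on_functions B \<rho>" "f2 \<in> B"
    and f1: "\<Delta>A f1 = (\<lambda>(x, x'). \<Sum>i<I. a i x * a' i x')"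
    and f2: "\<Delta>B f2 = (\<lambda>(y, y'). \<Sum>j<J. b j y * b' j y')" "\<forall>j<J. b j \<in> B"
    and b: "\<And>j. j < J \<Longrightarrow> \<rho> (b j) = (\<lambda>(y, x). \<Sum>l<K j. c j l y * d j l x)"
  shows "bicrossed_comult \<Delta>A \<Delta>B \<rho> (\<lambda>(x, y). f1 x * f2 y) = (\<lambda>((x1, y1), (x2, y2)).
    \<Sum>i<I. \<Sum>j<J. \<Sum>l<K j. (a i x1 * c j l y1) * ((a' i x2 * d j l x2) * b' j y2))"
proof -
  have B1: "\<Delta>B (\<lambda>y. k * f2 y) = (\<lambda>y. k * \<Delta>B f2 y)" for k
    by (rule linear_on_functions_scale[OF B(2) B(4)])
  have rho: "\<rho> (\<lambda>y. k * (\<Sum>j<J. b j y * b' j y2)) (y1, x2)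
      = k * (\<Sum>j<J. \<Sum>l<K j. c j l y1 * d j l x2 * b' j y2)" for k y1 y2 x2
  proof -
    have "\<rho> (\<lambda>y. \<Sum>j<J. (k * b' j y2) * b j y) (y1, x2) = (\<Sum>j<J. (k * b' j y2) * \<rho> (b j) (y1, x2))"
      using linear_on_functions_sum[OF B(1) B(3), of J b "\<lambda>j. k * b' j y2"] f2 by simp
    also have "\<dots> = k * (\<Sum>j<J. \<Sum>l<K j. c j l y1 * d j l x2 * b' j y2)"
      by (simp add: b sum_distrib_left mult_ac)
    finally show ?thesis by (simp add: sum_distrib_left mult_ac)
  qed
  have A1: "\<Delta>A (\<lambda>x. f1 x * k) (x1, x2) = k * (\<Sum>i<I. a i x1 * a' i x2)" for k x1 x2
  proof -
    have "\<Delta>A (\<lambda>x. k * f1 x) = (\<lambda>x. k * \<Delta>A f1 x)"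
      by (rule linear_on_functions_scale[OF A(2) A(3)])
    then show ?thesis by (simp add: mult.commute f1)
  qed
  have "\<rho> (\<lambda>y. \<Delta>B (\<lambda>y. k * f2 y) (y, y2)) (y1, x2)
      = k * (\<Sum>j<J. \<Sum>l<K j. c j l y1 * d j l x2 * b' j y2)" for k y1 y2 x2
    using rho by (simp only: B1 f2(1) prod.case)
  then have "bicrossed_comult \<Delta>A \<Delta>B \<rho> (\<lambda>(x, y). f1 x * f2 y) ((x1, y1), (x2, y2))
      = (\<Sum>i<I. a i x1 * a' i x2) * (\<Sum>j<J. \<Sum>l<K j. c j l y1 * d j l x2 * b' j y2)" for x1 y1 x2 y2
    by (simp only: bicrossed_comult_def tensor_map_def prod.case id_apply A1 mult.commute)
  then have "bicrossed_comult \<Delta>A \<Delta>B \<rho> (\<lambda>(x, y). f1 x * f2 y) ((x1, y1), (x2, y2))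
      = (\<Sum>i<I. \<Sum>j<J. \<Sum>l<K j. (a i x1 * a' i x2) * (c j l y1 * d j l x2 * b' j y2))" for x1 y1 x2 y2
    by (simp only: sum_distrib_right[of _ "{..<I}"]) (simp only: sum_distrib_left)
  then show ?thesis
    by (simp add: fun_eq_iff mult_ac)
qed

text \<open>An antipode of a bialgebra is unique, so it need not be specified explicitly. It is only
  determined on the underlying algebra, hence the choice operator.\<close>

definition bicrossed_product ::
    "('x, 'k::field) hopf \<Rightarrow> ('y, 'k) hopf \<Rightarrow> (('y \<Rightarrow> 'k) \<Rightarrow> ('y \<times> 'x \<Rightarrow> 'k)) \<Rightarrow> ('x \<times> 'y, 'k) hopf" where
  "bicrossed_product H K \<rho> =
     (let A = hcarrier H \<otimes>\<^sub>f hcarrier K;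
          \<Delta> = bicrossed_comult (comult H) (comult K) \<rho>;
          \<epsilon> = (\<lambda>F. counit H (\<lambda>x. counit K (\<lambda>y. F (x, y))))
      in \<lparr>hcarrier = A, comult = \<Delta>, counit = \<epsilon>, antipode = (SOME S. is_antipode A \<Delta> \<epsilon> S)\<rparr>)"

definition beta :: "'n::finite \<Rightarrow> 'n list \<Rightarrow> 'n diff_grp \<Rightarrow> 'k::real_field" where
  "beta i js \<psi> = of_real (iter_partial js (\<lambda>x. diff_map \<psi> x $ i) 0)"

definition beta_inv :: "'n::finite diff_grp \<Rightarrow> 'k::real_field" where
  "beta_inv \<psi> = of_real (1 / det (jacobian (diff_map \<psi>) (at 0)))"

definition alpha_lin :: "'n::finite \<Rightarrow> 'n \<Rightarrow> 'n lin_grp \<Rightarrow> 'k::real_field" where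
  "alpha_lin i j l = of_real (partial_deriv j (\<lambda>x. lin_map l x $ i) 0)"

definition alpha_lin_inv :: "'n::finite lin_grp \<Rightarrow> 'k::real_field" where
  "alpha_lin_inv l = of_real (1 / det (jacobian (lin_map l) (at 0)))"

definition alpha_nil :: "'n::finite \<Rightarrow> 'n list \<Rightarrow> 'n nil_grp \<Rightarrow> 'k::real_field" where
  "alpha_nil i js \<nu> = of_real (iter_partial js (\<lambda>x. nil_map \<nu> x $ i) 0)"

definition F_diff :: "('n::finite diff_grp, 'k::real_field) hopf" where
  "F_diff = group_function_hopf
     (generated_algebra (insert beta_inv {beta i js | i js. length js \<ge> 1})) diff_mult diff_one diff_inv"

definition F_lin :: "('n::finite lin_grp, 'k::real_field) hopf" where
  "F_lin = group_function_hopf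
     (generated_algebra (insert alpha_lin_inv {alpha_lin i j | i j. True})) lin_mult lin_one lin_inv"

definition F_nil :: "('n::finite nil_grp, 'k::real_field) hopf" where
  "F_nil = group_function_hopf
     (generated_algebra {alpha_nil i js | i js. length js \<ge> 2}) nil_mult nil_one nil_inv"

definition coaction :: "('n::finite nil_grp \<Rightarrow> 'k::real_field) \<Rightarrow> ('n nil_grp \<times> 'n lin_grp \<Rightarrow> 'k)" where
  "coaction f = (\<lambda>(\<nu>, l). f (\<nu> \<triangleleft> l))"

definition Phi :: "('n::finite diff_grp \<Rightarrow> 'k::real_field) \<Rightarrow> ('n lin_grp \<times> 'n nil_grp \<Rightarrow> 'k)" where
  "Phi f = (\<lambda>(l, \<nu>). f (lin_nil_comp l \<nu>))"

end

theory Submission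
  imports Defs
begin

text \<open>
  The set \<open>G\<dagger>\<^sub>0 \<times> N\<close> carries the group law
  \<open>(l, \<nu>) (l', \<nu>') = (l l', (\<nu> \<triangleleft> l') \<nu>')\<close>, and for it the factorisation \<open>(l, \<nu>) \<mapsto> l \<circ> \<nu>\<close> is an
  isomorphism onto \<open>G\<dagger>\<close>. Unwinding the coproduct of the bicrossed product shows that it is
  \<open>F \<mapsto> F(p q)\<close> for this law, and its counit is evaluation at the unit. So \<open>\<Phi>\<close> is pullback along a
  group isomorphism, and every Hopf algebra axiom and every homomorphism property is an evaluation
  of a group identity. The antipode of the bicrossed product is given as some antipode; it agrees
  with \<open>F \<mapsto> F(p\<^sup>-\<^sup>1)\<close> since an antipode on a translation invariant algebra of functions on a group
  is forced to be inversion (\<open>antipode_group_function_unique\<close>).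

  What remains is that the algebras match up, and this is where the analysis lies.

  \<^item> The algebra of \<open>G\<dagger>\<close> is closed under coproduct and antipode (\<open>coord_diff_mult\<close>, \<open>coord_diff_inv\<close>).
    For the coproduct, the polynomials in
    the functions \<open>(\<partial>\<^sub>K \<phi>\<^sup>i) \<circ> \<psi>\<close> and \<open>\<partial>\<^sub>K \<psi>\<^sup>i\<close> are closed under partial derivatives by the
    chain rule, so they contain all derivatives of \<open>\<phi> \<circ> \<psi>\<close>; at \<open>0\<close> they become elements of the
    tensor product. For the antipode the same argument works with \<open>(\<partial>\<^sub>K \<psi>\<^sup>i) \<circ> \<psi>\<^sup>-\<^sup>1\<close> and
    \<open>(1 / det \<psi>') \<circ> \<psi>\<^sup>-\<^sup>1\<close>, since Cramer's rule expresses the first derivatives of \<open>\<psi>\<^sup>-\<^sup>1\<close> by these.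

  \<^item> \<open>\<Phi>\<close> maps onto the tensor product. It maps into it, since \<open>\<Phi> f\<close> is the coproduct of \<open>f\<close> restricted
    to \<open>G\<dagger>\<^sub>0 \<times> N\<close>. For the converse, functions of \<open>l\<close> and functions of \<open>\<nu>\<close> have to be regular
    functions of \<open>\<psi> = l \<circ> \<nu>\<close>. For \<open>l = \<psi>'(0)\<close> this is clear, and for \<open>\<nu> = l\<^sup>-\<^sup>1 \<circ> \<psi>\<close> it follows from
    the first item (\<open>coord_lin_extend\<close>, \<open>coord_nil_extend\<close>).
\<close>

section \<open>Algebras of functions and their tensor products\<close>

lemma function_algebra_const: "function_algebra A \<Longrightarrow> (\<lambda>_. c) \<in> A"
  using function_subspace_scale[of A "\<lambda>_. 1" c] by (simp add: function_algebra_def)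

lemma function_algebra_add:
  "function_algebra A \<Longrightarrow> f \<in> A \<Longrightarrow> g \<in> A \<Longrightarrow> (\<lambda>x. f x + g x) \<in> A"
  by (simp add: function_algebra_def function_subspace_def)

lemma function_algebra_mult:
  "function_algebra A \<Longrightarrow> f \<in> A \<Longrightarrow> g \<in> A \<Longrightarrow> (\<lambda>x. f x * g x) \<in> A"
  by (simp add: function_algebra_def)

lemma function_algebra_sum:
  "function_algebra A \<Longrightarrow> (\<And>i. i \<in> I \<Longrightarrow> f i \<in> A) \<Longrightarrow> (\<lambda>x. \<Sum>i\<in>I. f i x) \<in> A"
  by (induction I rule: infinite_finite_induct)
    (auto intro: function_algebra_add function_algebra_const)

lemma function_algebra_prod:
  "function_algebra A \<Longrightarrow> (\<And>i. i \<in> I \<Longrightarrow> f i \<in> A) \<Longrightarrow> (\<lambda>x. \<Prod>i\<in>I. f i x) \<in> A"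
  by (induction I rule: infinite_finite_induct)
    (auto intro: function_algebra_mult function_algebra_const)

lemma function_algebra_det:
  fixes M :: "'x \<Rightarrow> 'k::field^'n::finite^'n"
  assumes "function_algebra A" "\<And>i j. (\<lambda>x. M x $ i $ j) \<in> A"
  shows "(\<lambda>x. det (M x)) \<in> A"
  unfolding det_def using assms
  by (intro function_algebra_sum function_algebra_mult function_algebra_prod function_algebra_const)

lemma function_algebra_generated: "function_algebra (generated_algebra B)"
  unfolding function_algebra_def function_subspace_def
  by (intro conjI ballI allI generated_algebra.const generated_algebra.add
      generated_algebra.mult[OF generated_algebra.const] generated_algebra.mult; assumption)

lemma generated_algebra_pullback:
  assumes f: "f \<in> generated_algebra B" and C: "function_algebra C"
    and B: "\<And>b. b \<in> B \<Longrightarrow> (\<lambda>y. b (\<theta> y)) \<in> C"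
  shows "(\<lambda>y. f (\<theta> y)) \<in> C"
  using f
  by induction (auto intro: B function_algebra_const[OF C] function_algebra_add[OF C] function_algebra_mult[OF C])

lemma generated_algebra_pullback_of_real:
  fixes C :: "('y \<Rightarrow> 'k::real_field) set"
  assumes f: "f \<in> generated_algebra B" and C: "function_algebra C"
    and B: "\<And>b. b \<in> B \<Longrightarrow> (\<lambda>y. of_real (b (\<theta> y))) \<in> C"
  shows "(\<lambda>y. of_real (f (\<theta> y))) \<in> C"
  using f
  by induction (auto intro: B function_algebra_const[OF C] function_algebra_add[OF C] function_algebra_mult[OF C])

lemma function_tensorE:
  assumes "F \<in> A \<otimes>\<^sub>f B"
  obtains m :: nat and f g where "\<forall>i<m. f i \<in> A \<and> g i \<in> B"
    and "F = (\<lambda>(x, y). \<Sum>i<m. f i x * g i y)"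
  using assms unfolding function_tensor_def mem_Collect_eq by blast

text \<open>This is how membership in a tensor product is used throughout: substituting functions of a
  common variable for the two variables stays within an algebra that contains all substituted
  factors. Translations, restrictions and transport of structure are all of this form.\<close>

lemma function_tensor_pullback:
  assumes F: "F \<in> A \<otimes>\<^sub>f B" and C: "function_algebra C"
    and u: "\<And>f. f \<in> A \<Longrightarrow> (\<lambda>z. f (u z)) \<in> C" and v: "\<And>g. g \<in> B \<Longrightarrow> (\<lambda>z. g (v z)) \<in> C"
  shows "(\<lambda>z. F (u z, v z)) \<in> C"
proof -
  obtain m :: nat and f g where "\<forall>i<m. f i \<in> A \<and> g i \<in> B"
    and "F = (\<lambda>(x, y). \<Sum>i<m. f i x * g i y)"
    using F by (rule function_tensorE)
  then show ?thesis
    by (auto intro!: function_algebra_sum[OF C] function_algebra_mult[OF C] u v)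
qed

lemma function_tensorI:
  assumes "finite I" "\<And>i. i \<in> I \<Longrightarrow> f i \<in> A" "\<And>i. i \<in> I \<Longrightarrow> g i \<in> B"
  shows "(\<lambda>(x, y). \<Sum>i\<in>I. f i x * g i y) \<in> A \<otimes>\<^sub>f B"
proof -
  obtain h where h: "bij_betw h {..<card I} I"
    using ex_bij_betw_nat_finite[OF assms(1)] by (auto simp: atLeast0LessThan)
  then have "(\<Sum>i\<in>I. f i x * g i y) = (\<Sum>k<card I. f (h k) x * g (h k) y)" for x y
    by (rule sum.reindex_bij_betw[symmetric])
  then have "(\<lambda>(x, y). \<Sum>i\<in>I. f i x * g i y) = (\<lambda>(x, y). \<Sum>k<card I. f (h k) x * g (h k) y)"
    by simp
  moreover have "\<forall>k<card I. f (h k) \<in> A \<and> g (h k) \<in> B"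
    using assms bij_betwE[OF h] by auto
  ultimately show ?thesis
    unfolding function_tensor_def mem_Collect_eq by (intro exI conjI)
qed

lemma function_tensor_pure: "f \<in> A \<Longrightarrow> g \<in> B \<Longrightarrow> (\<lambda>p. f (fst p) * g (snd p)) \<in> A \<otimes>\<^sub>f B"
  using function_tensorI[of "{()}" "\<lambda>_. f" A "\<lambda>_. g" B] by (simp add: split_beta')

lemma function_algebra_tensor:
  assumes A: "function_algebra A" and B: "function_algebra B"
  shows "function_algebra (A \<otimes>\<^sub>f B)"
proof -
  have const: "(\<lambda>_. c) \<in> A \<otimes>\<^sub>f B" for c
    using function_tensor_pure[OF function_algebra_const[OF A, of c] function_algebra_const[OF B, of 1]]
    by simp
  have add: "(\<lambda>p. F p + G p) \<in> A \<otimes>\<^sub>f B" if FG: "F \<in> A \<otimes>\<^sub>f B" "G \<in> A \<otimes>\<^sub>f B" for F G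
  proof -
    obtain m :: nat and f g where F: "\<forall>i<m. f i \<in> A \<and> g i \<in> B"
      "F = (\<lambda>(x, y). \<Sum>i<m. f i x * g i y)" using FG(1) by (rule function_tensorE)
    obtain m' :: nat and f' g' where G: "\<forall>i<m'. f' i \<in> A \<and> g' i \<in> B"
      "G = (\<lambda>(x, y). \<Sum>i<m'. f' i x * g' i y)" using FG(2) by (rule function_tensorE)
    have "(\<lambda>(x, y). \<Sum>i\<in>{..<m} <+> {..<m'}. (case_sum f f' i) x * (case_sum g g' i) y) \<in> A \<otimes>\<^sub>f B"
      using F G by (intro function_tensorI) auto
    then show ?thesis
      by (simp add: F G sum.Plus split_beta')
  qed
  have mult: "(\<lambda>p. F p * G p) \<in> A \<otimes>\<^sub>f B" if FG: "F \<in> A \<otimes>\<^sub>f B" "G \<in> A \<otimes>\<^sub>f B" for F G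
  proof -
    obtain m :: nat and f g where F: "\<forall>i<m. f i \<in> A \<and> g i \<in> B"
      "F = (\<lambda>(x, y). \<Sum>i<m. f i x * g i y)" using FG(1) by (rule function_tensorE)
    obtain m' :: nat and f' g' where G: "\<forall>i<m'. f' i \<in> A \<and> g' i \<in> B"
      "G = (\<lambda>(x, y). \<Sum>i<m'. f' i x * g' i y)" using FG(2) by (rule function_tensorE)
    have "(\<lambda>(x, y). \<Sum>i\<in>{..<m} \<times> {..<m'}. (f (fst i) x * f' (snd i) x) * (g (fst i) y * g' (snd i) y))
        \<in> A \<otimes>\<^sub>f B"
      using F G by (intro function_tensorI function_algebra_mult[OF A] function_algebra_mult[OF B]) auto
    moreover have "(\<Sum>i\<in>{..<m} \<times> {..<m'}. (f (fst i) x * f' (snd i) x) * (g (fst i) y * g' (snd i) y))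
        = (\<Sum>i<m. f i x * g i y) * (\<Sum>i<m'. f' i x * g' i y)" for x y
      unfolding sum_product sum.cartesian_product by (simp add: split_beta' mult_ac)
    ultimately show ?thesis
      by (simp add: F G split_beta')
  qed
  show ?thesis
    unfolding function_algebra_def function_subspace_def
    by (intro conjI ballI allI const add mult[OF const] mult; assumption)
qed

lemma function_tensor_fst: "function_algebra B \<Longrightarrow> f \<in> A \<Longrightarrow> (\<lambda>p. f (fst p)) \<in> A \<otimes>\<^sub>f B"
  using function_tensor_pure[of f A "\<lambda>_. 1" B] by (simp add: function_algebra_const)

lemma function_tensor_snd: "function_algebra A \<Longrightarrow> g \<in> B \<Longrightarrow> (\<lambda>p. g (snd p)) \<in> A \<otimes>\<^sub>f B"
  using function_tensor_pure[of "\<lambda>_. 1" A g B] by (simp add: function_algebra_const)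

section \<open>Hopf algebras of functions on a group\<close>

lemma is_antipode_group_function:
  assumes G: "group mul e iv" and S: "\<And>f. f \<in> A \<Longrightarrow> (\<lambda>x. f (iv x)) \<in> A"
  shows "is_antipode A (\<lambda>f (x, y). f (mul x y)) (\<lambda>f. f e) (\<lambda>f x. f (iv x))"
proof -
  interpret group mul e iv by (rule G)
  show ?thesis
    using S by (auto simp: is_antipode_def linear_on_functions_def tensor_map_def)
qed

lemma bialgebra_group_function:
  assumes G: "group mul e iv" and A: "function_algebra A"
    and D: "\<And>f. f \<in> A \<Longrightarrow> (\<lambda>(x, y). f (mul x y)) \<in> A \<otimes>\<^sub>f A"
  shows "bialgebra A (\<lambda>f (x, y). f (mul x y)) (\<lambda>f. f e)"
proof -
  interpret group mul e iv by (rule G)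
  show ?thesis
    using D A by (auto simp: bialgebra_def algebra_hom_on_def linear_on_functions_def tensor_map_def
        fun_eq_iff assoc)
qed

text \<open>For \<open>h u = f (u x\<^sup>-\<^sup>1)\<close> the first leg \<open>u \<mapsto> \<Delta> h (u, x)\<close> of the coproduct is \<open>f\<close> itself, so the
  antipode axiom for \<open>h\<close>, evaluated at \<open>x\<close>, reads \<open>S f x = h e = f (x\<^sup>-\<^sup>1)\<close>. The translate \<open>h\<close> lies
  in \<open>A\<close> because \<open>A\<close> is closed under the coproduct.\<close>

lemma antipode_group_function_unique:
  assumes G: "group mul e iv" and A: "function_algebra A"
    and D: "\<And>f. f \<in> A \<Longrightarrow> (\<lambda>(x, y). f (mul x y)) \<in> A \<otimes>\<^sub>f A"
    and S: "is_antipode A (\<lambda>f (x, y). f (mul x y)) (\<lambda>f. f e) S" and f: "f \<in> A"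
  shows "S f = (\<lambda>x. f (iv x))"
proof
  interpret group mul e iv by (rule G)
  fix x
  define h where "h = (\<lambda>u. f (mul u (iv x)))"
  have "h \<in> A"
    using function_tensor_pullback[OF D[OF f] A, of "\<lambda>u. u" "\<lambda>_. iv x"]
    by (simp add: h_def function_algebra_const[OF A])
  then have "S (\<lambda>u. h (mul u x)) x = h e"
    using S by (auto simp: is_antipode_def tensor_map_def)
  then show "S f x = f (iv x)"
    by (simp add: h_def assoc)
qed

lemma hopf_algebra_group_function:
  assumes "group mul e iv" "function_algebra A"
    and "\<And>f. f \<in> A \<Longrightarrow> (\<lambda>(x, y). f (mul x y)) \<in> A \<otimes>\<^sub>f A"
    and "\<And>f. f \<in> A \<Longrightarrow> (\<lambda>x. f (iv x)) \<in> A"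
  shows "hopf_algebra (group_function_hopf A mul e iv)"
  using is_antipode_group_function[OF assms(1,4)] bialgebra_group_function[OF assms(1-3)]
  by (simp add: hopf_algebra_def group_function_hopf_def)

lemma group_transport:
  assumes G: "group mul e iv" and \<theta>: "bij \<theta>"
    and mul: "\<And>p q. \<theta> (mul' p q) = mul (\<theta> p) (\<theta> q)" and e: "\<theta> e' = e"
  shows "group mul' e' (\<lambda>p. inv \<theta> (iv (\<theta> p)))"
proof -
  interpret group mul e iv by (rule G)
  have inj: "p = q" if "\<theta> p = \<theta> q" for p q
    using \<theta> that by (auto simp: bij_def inj_def)
  have s: "\<theta> (inv \<theta> x) = x" for x
    using \<theta> by (simp add: bij_def surj_f_inv_f)
  show ?thesis
    by unfold_locales (rule inj, simp add: mul e s assoc)+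
qed

text \<open>The target is not assumed to be a Hopf algebra: its axioms are transported along \<open>\<theta>\<close>. Its antipode
  is only known to be chosen among the antipodes, so a witness has to be produced first, and then
  uniqueness identifies the choice with inversion in the transported group.\<close>

lemma hopf_iso_pullback:
  assumes G: "group mul e iv" and A: "function_algebra A"
    and D: "\<And>f. f \<in> A \<Longrightarrow> (\<lambda>(x, y). f (mul x y)) \<in> A \<otimes>\<^sub>f A"
    and S: "\<And>f. f \<in> A \<Longrightarrow> (\<lambda>x. f (iv x)) \<in> A"
    and \<theta>: "bij \<theta>" "\<And>p q. \<theta> (mul' p q) = mul (\<theta> p) (\<theta> q)" "\<theta> e' = e"
    and B: "function_algebra B" "\<And>f. f \<in> A \<Longrightarrow> (\<lambda>p. f (\<theta> p)) \<in> B"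
      "\<And>F. F \<in> B \<Longrightarrow> (\<lambda>x. F (inv \<theta> x)) \<in> A"
    and K: "hcarrier K = B" "comult K = (\<lambda>F (p, q). F (mul' p q))" "counit K = (\<lambda>F. F e')"
      "antipode K = (SOME S. is_antipode B (comult K) (counit K) S)"
  shows "hopf_iso (group_function_hopf A mul e iv) K (\<lambda>f p. f (\<theta> p))"
proof -
  let ?iv = "\<lambda>p. inv \<theta> (iv (\<theta> p))"
  have G': "group mul' e' ?iv"
    by (rule group_transport[OF G \<theta>])
  have s: "\<theta> (inv \<theta> x) = x" and i: "inv \<theta> (\<theta> p) = p" for x p
    using \<theta>(1) by (simp_all add: bij_def surj_f_inv_f)
  have D': "(\<lambda>(p, q). F (mul' p q)) \<in> B \<otimes>\<^sub>f B" if F: "F \<in> B" for F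
  proof -
    have "(\<lambda>r. (\<lambda>(x, y). F (inv \<theta> (mul x y))) (\<theta> (fst r), \<theta> (snd r))) \<in> B \<otimes>\<^sub>f B"
      using function_tensor_fst[OF B(1) B(2)] function_tensor_snd[OF B(1) B(2)]
      by (intro function_tensor_pullback[OF D[OF B(3)[OF F]]] function_algebra_tensor B)
    then show ?thesis
      by (simp add: \<theta>(2)[symmetric] i split_beta')
  qed
  have S': "(\<lambda>p. F (?iv p)) \<in> B" if F: "F \<in> B" for F
    by (rule B(2)[OF S[OF B(3)[OF F]]])
  have "is_antipode B (comult K) (counit K) (\<lambda>F p. F (?iv p))"
    unfolding K using G' S' by (rule is_antipode_group_function)
  then have anti: "is_antipode B (comult K) (counit K) (antipode K)"
    unfolding K(4) by (rule someI[where P = "is_antipode B (comult K) (counit K)"])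
  then have anti_eq: "antipode K F = (\<lambda>p. F (?iv p))" if "F \<in> B" for F
    using that unfolding K by (intro antipode_group_function_unique[OF G' B(1) D'])
  have "hopf_algebra K"
    unfolding hopf_algebra_def using anti bialgebra_group_function[OF G' B(1) D'] by (simp add: K)
  moreover have "hopf_hom (group_function_hopf A mul e iv) K (\<lambda>f p. f (\<theta> p))"
    using B(2) anti_eq \<theta>(2,3)
    by (auto simp: hopf_hom_def group_function_hopf_def K algebra_hom_on_def
        linear_on_functions_def tensor_map_def s)
  moreover have "bij_betw (\<lambda>f p. f (\<theta> p)) A B"
    by (rule bij_betw_byWitness[where f' = "\<lambda>F x. F (inv \<theta> x)"]) (use B in \<open>auto simp: s i\<close>)
  moreover have "hopf_algebra (group_function_hopf A mul e iv)"
    using G A D S by (rule hopf_algebra_group_function)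
  ultimately show ?thesis
    unfolding hopf_iso_def K(1) by (simp add: group_function_hopf_def)
qed

section \<open>Partial derivatives of polynomial expressions\<close>

lemma partial_deriv_add:
  assumes "f differentiable (at x)" "g differentiable (at x)"
  shows "partial_deriv j (\<lambda>x. f x + g x) x = partial_deriv j f x + partial_deriv j g x"
proof -
  obtain D E where D: "(f has_derivative D) (at x)" and E: "(g has_derivative E) (at x)"
    using assms by (auto simp: differentiable_def)
  show ?thesis
    using partial_deriv_eq[OF has_derivative_add[OF D E]] partial_deriv_eq[OF D]
      partial_deriv_eq[OF E] by simp
qed

lemma partial_deriv_mult:
  assumes "f differentiable (at x)" "g differentiable (at x)"
  shows "partial_deriv j (\<lambda>x. f x * g x) x = f x * partial_deriv j g x + partial_deriv j f x * g x"
proof -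
  obtain D E where D: "(f has_derivative D) (at x)" and E: "(g has_derivative E) (at x)"
    using assms by (auto simp: differentiable_def)
  show ?thesis
    using partial_deriv_eq[OF has_derivative_mult[OF D E]] partial_deriv_eq[OF D]
      partial_deriv_eq[OF E] by simp
qed

lemma partial_deriv_inverse:
  fixes f :: "real^'n::finite \<Rightarrow> real"
  assumes "f differentiable (at x)" "f x \<noteq> 0"
  shows "partial_deriv j (\<lambda>x. 1 / f x) x = - (1 / f x) * (1 / f x) * partial_deriv j f x"
    and "(\<lambda>x. 1 / f x) differentiable (at x)"
proof -
  obtain D where D: "(f has_derivative D) (at x)"
    using assms by (auto simp: differentiable_def)
  have d: "((\<lambda>x. 1 / f x) has_derivative (\<lambda>h. - (1 / f x) * (1 / f x) * D h)) (at x)"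
    using Deriv.has_derivative_inverse[OF assms(2) D] by (simp add: inverse_eq_divide mult_ac)
  then show "(\<lambda>x. 1 / f x) differentiable (at x)"
    by (auto simp: differentiable_def)
  show "partial_deriv j (\<lambda>x. 1 / f x) x = - (1 / f x) * (1 / f x) * partial_deriv j f x"
    using partial_deriv_eq[OF d] partial_deriv_eq[OF D] by simp
qed

text \<open>From here on a function on \<open>'p \<times> real^'n\<close> is regarded as a family of functions of \<open>x\<close>, with the
  diffeomorphisms as the parameter \<open>p\<close>. A generated algebra of such families consists of
  expressions that are polynomial uniformly in the parameter; this uniformity is what turns a
  statement about derivatives into one about functions on the group.\<close>

lemma differentiable_generated_algebra:
  fixes B :: "('p \<times> (real^'n::finite) \<Rightarrow> real) set"
  assumes f: "f \<in> generated_algebra B"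
    and B: "\<And>b p x. b \<in> B \<Longrightarrow> (\<lambda>x. b (p, x)) differentiable (at x)"
  shows "(\<lambda>x. f (p, x)) differentiable (at x)"
  using f by induction (auto intro: B)

text \<open>By the Leibniz rule it suffices to look at the generators. The target \<open>E\<close> may be larger than the
  algebra generated by \<open>B\<close>: the derivatives of the determinant of \<open>(\<partial>\<^sub>j \<psi>\<^sup>i) \<circ> \<psi>\<^sup>-\<^sup>1\<close> involve its
  reciprocal, which is not generated by these entries.\<close>

lemma partial_deriv_generated_algebra:
  fixes B :: "('p \<times> (real^'n::finite) \<Rightarrow> real) set"
  assumes f: "f \<in> generated_algebra B"
    and B: "\<And>b p x. b \<in> B \<Longrightarrow> (\<lambda>x. b (p, x)) differentiable (at x)"
    and E: "function_algebra E" "B \<subseteq> E"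
      "\<And>b. b \<in> B \<Longrightarrow> (\<lambda>(p, x). partial_deriv j (\<lambda>x. b (p, x)) x) \<in> E"
  shows "(\<lambda>(p, x). partial_deriv j (\<lambda>x. f (p, x)) x) \<in> E"
proof -
  note d = differentiable_generated_algebra[OF _ B]
  have E': "g \<in> E" if "g \<in> generated_algebra B" for g
    using generated_algebra_pullback[OF that E(1), of id] E(2) by auto
  show ?thesis
    using f
  proof induction
    case (gen b)
    then show ?case by (rule E(3))
  next
    case (const c)
    show ?case
      using function_algebra_const[OF E(1), of 0] by (simp add: partial_deriv_const split_beta')
  next
    case (add f g)
    then show ?case
      using function_algebra_add[OF E(1) add.IH] by (simp add: partial_deriv_add d split_beta')
  next
    case (mult f g)
    note 1 = function_algebra_mult[OF E(1) E'[OF mult.hyps(1)] mult.IH(2)]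
    note 2 = function_algebra_mult[OF E(1) mult.IH(1) E'[OF mult.hyps(2)]]
    show ?case
      using function_algebra_add[OF E(1) 1 2] mult.hyps by (simp add: partial_deriv_mult d split_beta')
  qed
qed

lemma iter_partial_Cons: "iter_partial (j # js) f = iter_partial js (partial_deriv j f)"
  by (simp add: iter_partial_def)

lemma iter_partial_snoc: "iter_partial (js @ [j]) f = partial_deriv j (iter_partial js f)"
  by (simp add: iter_partial_def)

lemma iter_partial_generated_algebra:
  fixes B :: "('p \<times> (real^'n::finite) \<Rightarrow> real) set"
  assumes f: "f \<in> generated_algebra B"
    and B: "\<And>b p x. b \<in> B \<Longrightarrow> (\<lambda>x. b (p, x)) differentiable (at x)"
      "\<And>b j. b \<in> B \<Longrightarrow> (\<lambda>(p, x). partial_deriv j (\<lambda>x. b (p, x)) x) \<in> generated_algebra B"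
  shows "(\<lambda>(p, x). iter_partial js (\<lambda>x. f (p, x)) x) \<in> generated_algebra B"
  using f
proof (induction js arbitrary: f)
  case Nil
  then show ?case by (simp add: iter_partial_def)
next
  case (Cons j js)
  have "(\<lambda>(p, x). partial_deriv j (\<lambda>x. f (p, x)) x) \<in> generated_algebra B"
    by (rule partial_deriv_generated_algebra[OF Cons.prems B(1) function_algebra_generated])
       (auto intro: generated_algebra.gen B(2))
  from Cons.IH[OF this] show ?case
    by (simp add: iter_partial_Cons)
qed

section \<open>Derivatives of composites and inverses\<close>

lemma smooth_iter_partial: "smooth f \<Longrightarrow> smooth (iter_partial js f)"
  by (induction js arbitrary: f) (simp_all add: iter_partial_def smooth_partial)

lemma partial_deriv_jacobian:
  assumes "smooth_map \<psi>"
  shows "partial_deriv j (\<lambda>x. \<psi> x $ i) x = jacobian \<psi> (at x) $ i $ j"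
proof -
  have "((\<lambda>x. \<psi> x $ i) has_derivative (\<lambda>h. (jacobian \<psi> (at x) *v h) $ i)) (at x)"
    using bounded_linear.has_derivative[OF bounded_linear_vec_nth smooth_map_has_derivative[OF assms]] .
  then show ?thesis
    by (simp add: partial_deriv_eq matrix_vector_mult_basis column_def)
qed

lemma diff_map_simps:
  "diff_map (diff_mult \<phi> \<psi>) = diff_map \<phi> \<circ> diff_map \<psi>"
  "diff_map (diff_inv \<psi>) = inv (diff_map \<psi>)"
  by (transfer, simp)+

lemma diff_map_diffeo: "orientation_preserving_diffeo (diff_map \<psi>)"
  using diff_map[of \<psi>] by (simp add: diff_set_def)

lemma diff_map_smooth: "smooth_map (diff_map \<psi>)"
  using diff_map_diffeo[of \<psi>] by (simp add: orientation_preserving_diffeo_def)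

lemma diff_map_0: "diff_map \<psi> 0 = 0"
  using diff_map[of \<psi>] by (simp add: diff_set_def)

lemma iter_partial_diff_map_differentiable:
  "iter_partial js (\<lambda>x. diff_map \<psi> x $ i) differentiable (at x)"
  using diff_map_smooth[of \<psi>]
  by (auto simp: smooth_map_def intro: smooth_differentiable smooth_iter_partial)

lemma partial_deriv_iter_partial_compose:
  "partial_deriv j (\<lambda>x. iter_partial ks (\<lambda>x. diff_map \<phi> x $ i) (diff_map \<psi> x)) x
    = (\<Sum>m\<in>UNIV. iter_partial (ks @ [m]) (\<lambda>x. diff_map \<phi> x $ i) (diff_map \<psi> x)
        * partial_deriv j (\<lambda>x. diff_map \<psi> x $ m) x)" (is ?eq)
  and iter_partial_compose_differentiable:
  "(\<lambda>x. iter_partial ks (\<lambda>x. diff_map \<phi> x $ i) (diff_map \<psi> x)) differentiable (at x)" (is ?diff)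
proof -
  have f: "iter_partial ks (\<lambda>x. diff_map \<phi> x $ i) differentiable (at (diff_map \<psi> x))"
    by (rule iter_partial_diff_map_differentiable)
  have g: "(\<lambda>x. diff_map \<psi> x $ i) differentiable (at x)" for i
    using iter_partial_diff_map_differentiable[of "[]" \<psi> i x] by (simp add: iter_partial_def)
  show ?eq unfolding iter_partial_snoc by (rule partial_deriv_compose(1)[OF f g])
  show ?diff by (rule partial_deriv_compose(2)[OF f g])
qed

definition coord_diff :: "('n::finite diff_grp \<Rightarrow> 'k::real_field) set" where
  "coord_diff = generated_algebra (insert beta_inv {beta i js | i js. length js \<ge> 1})"

lemma function_algebra_coord_diff: "function_algebra coord_diff"
  unfolding coord_diff_def by (rule function_algebra_generated)

lemma beta_in_coord_diff: "js \<noteq> [] \<Longrightarrow> beta i js \<in> coord_diff"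
  unfolding coord_diff_def length_greater_0_conv[symmetric] One_nat_def Suc_le_eq
  by (rule generated_algebra.gen) blast

lemma beta_inv_in_coord_diff: "beta_inv \<in> coord_diff"
  unfolding coord_diff_def by (rule generated_algebra.gen) (rule insertI1)

lemma coord_diff_pullback:
  assumes "f \<in> coord_diff" "function_algebra C" "(\<lambda>y. beta_inv (\<theta> y)) \<in> C"
    and "\<And>i js. js \<noteq> [] \<Longrightarrow> (\<lambda>y. beta i js (\<theta> y)) \<in> C"
  shows "(\<lambda>y. f (\<theta> y)) \<in> C"
proof (rule generated_algebra_pullback[OF assms(1)[unfolded coord_diff_def] assms(2)])
  fix b :: "'a diff_grp \<Rightarrow> 'b"
  assume "b \<in> insert beta_inv {beta i js | i js. length js \<ge> 1}"
  then consider "b = beta_inv" | i js where "b = beta i js" "length js \<ge> 1"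
    by blast
  then show "(\<lambda>y. b (\<theta> y)) \<in> C"
    by cases (use assms(3,4) in \<open>auto simp: Suc_le_eq\<close>)
qed

text \<open>The families \<open>out\<close> and \<open>inn\<close> below are the derivatives of the outer map at \<open>\<psi> x\<close> and those of the
  inner map at \<open>x\<close>. The value \<open>\<phi>\<^sup>i \<circ> \<psi>\<close> itself is no generator, as the functions \<open>\<beta>\<close> start in order one;
  but its first derivatives are polynomials in the generators, and the remaining derivatives
  stay in their algebra.\<close>

lemma beta_mult_in_tensor:
  assumes "js \<noteq> []"
  shows "(\<lambda>(\<phi>, \<psi>). beta i js (diff_mult \<phi> \<psi>))
    \<in> (coord_diff :: ('n::finite diff_grp \<Rightarrow> 'k::real_field) set) \<otimes>\<^sub>f coord_diff"
proof -
  let ?C = "(coord_diff :: ('n diff_grp \<Rightarrow> 'k) set) \<otimes>\<^sub>f coord_diff"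
  define out where "out i ks = (\<lambda>(p :: 'n diff_grp \<times> 'n diff_grp, x).
    iter_partial ks (\<lambda>x. diff_map (fst p) x $ i) (diff_map (snd p) x))" for i and ks :: "'n list"
  define inn where "inn i ks = (\<lambda>(p :: 'n diff_grp \<times> 'n diff_grp, x).
    iter_partial ks (\<lambda>x. diff_map (snd p) x $ i) x)" for i and ks :: "'n list"
  define B where "B = {out i ks | i ks. ks \<noteq> []} \<union> {inn i ks | i ks. ks \<noteq> []}"
  have out_d: "(\<lambda>(p, x). partial_deriv j (\<lambda>x. out i ks (p, x)) x) \<in> generated_algebra B" for i ks j
  proof -
    have eq: "(\<lambda>(p, x). partial_deriv j (\<lambda>x. out i ks (p, x)) x)
        = (\<lambda>q. \<Sum>m\<in>UNIV. out i (ks @ [m]) q * inn m [j] q)"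
      unfolding out_def inn_def
      by (simp add: partial_deriv_iter_partial_compose iter_partial_Cons fun_eq_iff)
         (simp add: iter_partial_def)
    show ?thesis
      unfolding eq
      by (intro function_algebra_sum function_algebra_mult function_algebra_generated
          generated_algebra.gen) (auto simp: B_def)
  qed
  have inn_d: "(\<lambda>(p, x). partial_deriv j (\<lambda>x. inn i ks (p, x)) x) = inn i (ks @ [j])" for i ks j
    by (simp add: inn_def iter_partial_snoc fun_eq_iff)
  obtain j js' where js: "js = j # js'" using assms by (cases js) auto
  have diff: "(\<lambda>x. b (p, x)) differentiable (at x)" if "b \<in> B" for b p x
    using that unfolding B_def out_def inn_def
    by (auto simp: iter_partial_compose_differentiable iter_partial_diff_map_differentiable)
  have closed: "(\<lambda>(p, x). partial_deriv j (\<lambda>x. b (p, x)) x) \<in> generated_algebra B" if b: "b \<in> B" for b j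
  proof (cases "\<exists>i ks. b = out i ks")
    case True
    then show ?thesis using out_d by blast
  next
    case False
    then obtain i ks where "b = inn i ks" using b unfolding B_def by blast
    then show ?thesis unfolding \<open>b = inn i ks\<close> inn_d by (intro generated_algebra.gen) (auto simp: B_def)
  qed
  have "(\<lambda>(p, x). iter_partial js' (\<lambda>x. (\<lambda>(p, x). partial_deriv j (\<lambda>x. out i [] (p, x)) x) (p, x)) x)
      \<in> generated_algebra B"
    by (rule iter_partial_generated_algebra[OF out_d diff closed])
  then have E: "(\<lambda>(p, x). iter_partial js (\<lambda>x. out i [] (p, x)) x) \<in> generated_algebra B"
    by (simp add: js iter_partial_Cons)
  \<comment> \<open>At \<open>x = 0\<close> the argument \<open>\<psi> x\<close> of the outer derivatives is \<open>0\<close> too, so they become \<open>\<beta>(\<phi>)\<close>.\<close>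
  have "(\<lambda>p. of_real ((\<lambda>(p, x). iter_partial js (\<lambda>x. out i [] (p, x)) x) (p, 0))) \<in> ?C"
  proof (rule generated_algebra_pullback_of_real[OF E])
    show "function_algebra ?C"
      by (intro function_algebra_tensor function_algebra_coord_diff)
    fix b assume "b \<in> B"
    then obtain i ks where ks: "ks \<noteq> []" and b: "b = out i ks \<or> b = inn i ks"
      unfolding B_def by blast
    have "(\<lambda>p. of_real (out i ks (p, 0)) :: 'k) = (\<lambda>p. beta i ks (fst p))"
      by (simp add: out_def beta_def diff_map_0)
    moreover have "(\<lambda>p. of_real (inn i ks (p, 0)) :: 'k) = (\<lambda>p. beta i ks (snd p))"
      by (simp add: inn_def beta_def)
    ultimately show "(\<lambda>p. of_real (b (p, 0))) \<in> ?C"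
      using b function_tensor_fst[OF function_algebra_coord_diff beta_in_coord_diff[OF ks]]
        function_tensor_snd[OF function_algebra_coord_diff beta_in_coord_diff[OF ks]] by auto
  qed
  then show ?thesis
    by (simp add: out_def beta_def diff_map_simps split_beta' iter_partial_def[of "[]"])
qed

lemma coord_diff_mult:
  fixes f :: "'n::finite diff_grp \<Rightarrow> 'k::real_field"
  assumes "f \<in> coord_diff"
  shows "(\<lambda>(\<phi>, \<psi>). f (diff_mult \<phi> \<psi>)) \<in> coord_diff \<otimes>\<^sub>f coord_diff"
proof -
  let ?C = "coord_diff \<otimes>\<^sub>f coord_diff :: ('n diff_grp \<times> 'n diff_grp \<Rightarrow> 'k) set"
  have "(\<lambda>p. f (diff_mult (fst p) (snd p))) \<in> ?C"
  proof (rule coord_diff_pullback[OF assms])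
    show "function_algebra ?C"
      by (intro function_algebra_tensor function_algebra_coord_diff)
    have "(\<lambda>p :: 'n diff_grp \<times> 'n diff_grp. beta_inv (diff_mult (fst p) (snd p)) :: 'k)
        = (\<lambda>p. beta_inv (fst p) * beta_inv (snd p))"
      by (simp add: beta_inv_def diff_map_simps diff_map_0 jacobian_compose diff_map_smooth det_mul)
    then show "(\<lambda>p. beta_inv (diff_mult (fst p) (snd p))) \<in> ?C"
      using function_tensor_pure[OF beta_inv_in_coord_diff beta_inv_in_coord_diff] by simp
    show "(\<lambda>p. beta i js (diff_mult (fst p) (snd p))) \<in> ?C" if "js \<noteq> []" for i js
      using beta_mult_in_tensor[OF that] by (simp add: split_beta')
  qed
  then show ?thesis by (simp add: split_beta')
qed

text \<open>The \<open>j\<close>-th column of the derivative of the inverse solves \<open>J v = e\<^sub>j\<close>; Cramer's rule makes the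
  dependence on \<open>J\<close> polynomial up to the factor \<open>1 / det J\<close>.\<close>

lemma partial_deriv_inv:
  fixes \<psi> :: "real^'n::finite \<Rightarrow> real^'n"
  assumes "orientation_preserving_diffeo \<psi>"
  defines "J \<equiv> \<lambda>x. jacobian \<psi> (at (inv \<psi> x))"
  shows "partial_deriv j (\<lambda>x. inv \<psi> x $ m) x
    = 1 / det (J x) * det (\<chi> i l. if l = m then axis j 1 $ i else J x $ i $ l)"
proof -
  have "J x *v column j (jacobian (inv \<psi>) (at x)) = axis j 1"
    using jacobian_inv[OF assms(1), of x]
    by (metis J_def matrix_vector_mul_assoc matrix_vector_mul_lid matrix_vector_mult_basis)
  moreover have "det (J x) \<noteq> 0"
    using assms by (auto simp: orientation_preserving_diffeo_def) (metis less_irrefl)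
  ultimately have "column j (jacobian (inv \<psi>) (at x))
      = (\<chi> k. det (\<chi> i l. if l = k then axis j 1 $ i else J x $ i $ l) / det (J x))"
    by (simp add: cramer)
  then have "jacobian (inv \<psi>) (at x) $ m $ j
      = det (\<chi> i l. if l = m then axis j 1 $ i else J x $ i $ l) / det (J x)"
    by (simp add: column_def vec_eq_iff)
  then show ?thesis
    using assms(1) by (simp add: partial_deriv_jacobian orientation_preserving_diffeo_def)
qed

text \<open>The derivatives of the inverse are polynomials in the derivatives of \<open>\<psi>\<close> at \<open>\<psi>\<^sup>-\<^sup>1 x\<close> and in the
  reciprocal of \<open>det \<psi>'(\<psi>\<^sup>-\<^sup>1 x)\<close>. Evaluation at \<open>x = 0\<close>, which is fixed by \<open>\<psi>\<^sup>-\<^sup>1\<close>, turns these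
  families into the generators of the algebra on the group.\<close>

lemma beta_diff_inv_in_coord_diff:
  shows "js \<noteq> [] \<Longrightarrow> (\<lambda>\<psi>. beta i js (diff_inv \<psi>)) \<in> (coord_diff :: ('n::finite diff_grp \<Rightarrow> 'k::real_field) set)"
    and "(\<lambda>\<psi>. beta_inv (diff_inv \<psi>)) \<in> (coord_diff :: ('n::finite diff_grp \<Rightarrow> 'k::real_field) set)"
proof -
  let ?C = "coord_diff :: ('n diff_grp \<Rightarrow> 'k) set"
  define out where "out i ks = (\<lambda>(\<psi> :: 'n diff_grp, x).
    iter_partial ks (\<lambda>x. diff_map \<psi> x $ i) (diff_map (diff_inv \<psi>) x))" for i and ks :: "'n list"
  define J where "J = (\<lambda>(\<psi> :: 'n diff_grp, x). jacobian (diff_map \<psi>) (at (diff_map (diff_inv \<psi>) x)))"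
  define dinv where "dinv = (\<lambda>q. 1 / det (J q))"
  define B\<^sub>0 where "B\<^sub>0 = {out i ks | i ks. ks \<noteq> []}"
  define B where "B = insert dinv B\<^sub>0"
  have J: "(\<lambda>q. J q $ i $ j) = out i [j]" for i j
    by (simp add: J_def out_def iter_partial_Cons partial_deriv_jacobian diff_map_smooth fun_eq_iff)
       (simp add: iter_partial_def partial_deriv_jacobian diff_map_smooth)
  have "det (J q) > 0" for q
    using diff_map_diffeo[of "fst q"] by (simp add: J_def orientation_preserving_diffeo_def split_beta')
  then have J0: "det (J q) \<noteq> 0" for q
    by (metis less_irrefl)
  have out_B: "out i ks \<in> generated_algebra B" if "ks \<noteq> []" for i ks
    using that by (intro generated_algebra.gen) (auto simp: B_def B\<^sub>0_def)
  have dinv_B: "dinv \<in> generated_algebra B"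
    by (intro generated_algebra.gen) (simp add: B_def)
  have inv_d: "(\<lambda>(\<psi>, x). partial_deriv j (\<lambda>x. diff_map (diff_inv \<psi>) x $ m) x) \<in> generated_algebra B"
    for j m
  proof -
    have eq: "(\<lambda>(\<psi>, x). partial_deriv j (\<lambda>x. diff_map (diff_inv \<psi>) x $ m) x)
      = (\<lambda>q. dinv q * det (\<chi> i l. if l = m then axis j 1 $ i else J q $ i $ l))"
      by (simp add: dinv_def J_def diff_map_simps partial_deriv_inv diff_map_diffeo fun_eq_iff cong: if_cong)
    have "(\<lambda>q. (\<chi> i l. if l = m then axis j 1 $ i else J q $ i $ l) $ i $ l) \<in> generated_algebra B" for i l
      using out_B[of "[l]" i] by (cases "l = m") (simp_all add: J generated_algebra.const)
    then show ?thesis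
      unfolding eq
      by (intro function_algebra_mult function_algebra_det function_algebra_generated dinv_B)
  qed
  have out_d: "(\<lambda>(\<psi>, x). partial_deriv j (\<lambda>x. out i ks (\<psi>, x)) x) \<in> generated_algebra B" for i ks j
  proof -
    have eq: "(\<lambda>(\<psi>, x). partial_deriv j (\<lambda>x. out i ks (\<psi>, x)) x)
        = (\<lambda>q. \<Sum>m\<in>UNIV. out i (ks @ [m]) q
            * (\<lambda>(\<psi>, x). partial_deriv j (\<lambda>x. diff_map (diff_inv \<psi>) x $ m) x) q)"
      unfolding out_def by (simp add: partial_deriv_iter_partial_compose fun_eq_iff)
    show ?thesis
      unfolding eq
      by (intro function_algebra_sum function_algebra_mult function_algebra_generated out_B inv_d) auto
  qed
  have diff\<^sub>0: "(\<lambda>x. b (\<psi>, x)) differentiable (at x)" if "b \<in> B\<^sub>0" for b \<psi> x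
    using that unfolding B\<^sub>0_def out_def by (auto simp: iter_partial_compose_differentiable)
  have det_B\<^sub>0: "(\<lambda>q. det (J q)) \<in> generated_algebra B\<^sub>0"
    by (rule function_algebra_det[OF function_algebra_generated], unfold J, rule generated_algebra.gen)
       (auto simp: B\<^sub>0_def)
  note det_diff = differentiable_generated_algebra[OF det_B\<^sub>0 diff\<^sub>0]
  have det_d: "(\<lambda>(\<psi>, x). partial_deriv j (\<lambda>x. det (J (\<psi>, x))) x) \<in> generated_algebra B" for j
  proof (rule partial_deriv_generated_algebra[OF det_B\<^sub>0 diff\<^sub>0 function_algebra_generated])
    show "B\<^sub>0 \<subseteq> generated_algebra B" by (auto simp: B_def intro: generated_algebra.gen)
    show "(\<lambda>(p, x). partial_deriv j (\<lambda>x. b (p, x)) x) \<in> generated_algebra B" if "b \<in> B\<^sub>0" for b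
      using that out_d unfolding B\<^sub>0_def by blast
  qed
  have dinv_d: "(\<lambda>(\<psi>, x). partial_deriv j (\<lambda>x. dinv (\<psi>, x)) x) \<in> generated_algebra B" for j
  proof -
    have eq: "(\<lambda>(\<psi>, x). partial_deriv j (\<lambda>x. dinv (\<psi>, x)) x)
        = (\<lambda>q. (- 1 * dinv q * dinv q) * (\<lambda>(\<psi>, x). partial_deriv j (\<lambda>x. det (J (\<psi>, x))) x) q)"
      unfolding dinv_def using det_diff J0 by (simp add: partial_deriv_inverse(1) fun_eq_iff)
    show ?thesis
      unfolding eq by (intro function_algebra_mult function_algebra_generated det_d dinv_B
          function_algebra_const)
  qed
  have diff: "(\<lambda>x. b (\<psi>, x)) differentiable (at x)" if "b \<in> B" for b \<psi> x
    using that diff\<^sub>0 det_diff J0 unfolding B_def dinv_def by (auto intro: partial_deriv_inverse(2))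
  have closed: "(\<lambda>(p, x). partial_deriv j (\<lambda>x. b (p, x)) x) \<in> generated_algebra B" if "b \<in> B" for b j
    using that out_d dinv_d unfolding B_def B\<^sub>0_def by blast
  have inv0: "diff_map (diff_inv \<psi>) 0 = 0" for \<psi> :: "'n diff_grp"
    by (rule diff_map_0)
  have at_0: "(\<lambda>\<psi>. of_real (f (\<psi>, 0))) \<in> ?C" if "f \<in> generated_algebra B" for f
  proof (rule generated_algebra_pullback_of_real[OF that function_algebra_coord_diff])
    fix b assume "b \<in> B"
    then consider "b = dinv" | i ks where "b = out i ks" "ks \<noteq> []"
      unfolding B_def B\<^sub>0_def by blast
    then show "(\<lambda>\<psi>. of_real (b (\<psi>, 0))) \<in> ?C"
    proof cases
      case 1
      have "(\<lambda>\<psi>. of_real (b (\<psi>, 0))) = (beta_inv :: 'n diff_grp \<Rightarrow> 'k)"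
        unfolding 1 by (simp add: dinv_def J_def inv0 beta_inv_def fun_eq_iff)
      then show ?thesis by (simp add: beta_inv_in_coord_diff)
    next
      case 2
      have "(\<lambda>\<psi>. of_real (b (\<psi>, 0))) = (beta i ks :: 'n diff_grp \<Rightarrow> 'k)"
        unfolding 2 by (simp add: out_def inv0 beta_def fun_eq_iff)
      then show ?thesis using 2 by (simp add: beta_in_coord_diff)
    qed
  qed
  show "(\<lambda>\<psi>. beta i js (diff_inv \<psi>)) \<in> ?C" if nonempty: "js \<noteq> []"
  proof -
    obtain j js' where js: "js = j # js'" using nonempty by (cases js) auto
    have "(\<lambda>(\<psi>, x). iter_partial js' (\<lambda>x. (\<lambda>(\<psi>, x). partial_deriv j (\<lambda>x. diff_map (diff_inv \<psi>) x $ i) x) (\<psi>, x)) x)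
        \<in> generated_algebra B"
      by (rule iter_partial_generated_algebra[OF inv_d diff closed])
    from at_0[OF this] show ?thesis
      by (simp add: beta_def js iter_partial_Cons)
  qed
  have "(\<lambda>\<psi>. of_real (det (J (\<psi>, 0)))) \<in> ?C"
    using out_B by (intro at_0 function_algebra_det function_algebra_generated) (simp add: J)
  moreover have "beta_inv (diff_inv \<psi>) = (of_real (det (J (\<psi>, 0))) :: 'k)" for \<psi>
  proof -
    have "det (J (\<psi>, 0)) * det (jacobian (diff_map (diff_inv \<psi>)) (at 0)) = 1"
      using jacobian_inv[OF diff_map_diffeo, of \<psi> 0]
      by (simp add: J_def diff_map_simps flip: det_mul)
    then have "1 / det (jacobian (diff_map (diff_inv \<psi>)) (at 0)) = det (J (\<psi>, 0))"
      by (auto simp: divide_eq_eq)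
    then show ?thesis
      by (simp only: beta_inv_def)
  qed
  ultimately show "(\<lambda>\<psi>. beta_inv (diff_inv \<psi>)) \<in> ?C"
    by simp
qed

lemma coord_diff_inv:
  assumes "f \<in> coord_diff"
  shows "(\<lambda>\<psi>. f (diff_inv \<psi>)) \<in> coord_diff"
  by (rule coord_diff_pullback[OF assms function_algebra_coord_diff beta_diff_inv_in_coord_diff(2,1)])

section \<open>Splitting off the linear part\<close>

lemma linear_part_in_lin_set:
  assumes "\<psi> \<in> diff_set"
  shows "(\<lambda>x. jacobian \<psi> (at 0) *v x) \<in> lin_set"
proof -
  define J where "J = jacobian \<psi> (at 0)"
  have J: "det J > 0"
    using assms by (simp add: J_def diff_set_def orientation_preserving_diffeo_def)
  define K where "K = jacobian (inv \<psi>) (at 0)"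
  have KJ: "J ** K = mat 1" "K ** J = mat 1"
    using diff_set_jacobian_inv[OF assms] by (simp_all add: J_def K_def)
  have comp: "(\<lambda>x. K *v x) \<circ> (\<lambda>x. J *v x) = id" "(\<lambda>x. J *v x) \<circ> (\<lambda>x. K *v x) = id"
    by (simp_all add: fun_eq_iff matrix_vector_mul_assoc KJ)
  have "bij (\<lambda>x. J *v x)"
    by (rule o_bij[OF comp])
  moreover have "inv (\<lambda>x. J *v x) = (\<lambda>x. K *v x)"
    by (rule inv_unique_comp[OF comp(2,1)])
  ultimately show ?thesis
    using J by (auto simp: lin_set_def diff_set_def orientation_preserving_diffeo_def
        smooth_map_linear jacobian_matrix simp flip: J_def)
qed

lift_definition lin_part :: "'n::finite diff_grp \<Rightarrow> 'n lin_grp"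
  is "\<lambda>\<psi> x. jacobian \<psi> (at 0) *v x" by (rule linear_part_in_lin_set)

lemma lin_set_jacobian: "l \<in> lin_set \<Longrightarrow> (\<lambda>x. jacobian l (at 0) *v x) = l"
  by (auto simp: lin_set_def jacobian_matrix)

lemma diff_set_bij: "\<psi> \<in> diff_set \<Longrightarrow> bij \<psi>"
  by (simp add: diff_set_def orientation_preserving_diffeo_def)

lift_definition nil_part :: "'n::finite diff_grp \<Rightarrow> 'n nil_grp"
  is "\<lambda>\<psi>. inv (\<lambda>x. jacobian \<psi> (at 0) *v x) \<circ> \<psi>"
proof -
  fix \<psi> :: "real^'n \<Rightarrow> real^'n"
  assume \<psi>: "\<psi> \<in> diff_set"
  let ?L = "\<lambda>x. jacobian \<psi> (at 0) *v x"
  have L: "?L \<in> diff_set"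
    using linear_part_in_lin_set[OF \<psi>] by (simp add: lin_set_def)
  show "inv ?L \<circ> \<psi> \<in> nil_set"
    using diff_set_jacobian_inv(2)[OF L] diff_set_inv[OF L] \<psi>
    by (simp add: nil_set_def diff_set_compose diff_set_jacobian_compose jacobian_matrix)
qed

lemma lin_part_comp: "lin_part (lin_nil_comp l \<nu>) = l"
  by transfer
    (auto simp: lin_set_def nil_set_def diff_set_jacobian_compose jacobian_matrix)

lemma nil_part_comp: "nil_part (lin_nil_comp l \<nu>) = \<nu>"
proof transfer
  fix l \<nu> :: "real^'n \<Rightarrow> real^'n"
  assume l: "l \<in> lin_set" and \<nu>: "\<nu> \<in> nil_set"
  then have "jacobian (l \<circ> \<nu>) (at 0) = jacobian l (at 0)"
    by (simp add: lin_set_def nil_set_def diff_set_jacobian_compose)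
  moreover have "inv l \<circ> l = id"
    using l by (simp add: lin_set_def diff_set_bij bij_is_inj)
  ultimately show "inv (\<lambda>x. jacobian (l \<circ> \<nu>) (at 0) *v x) \<circ> (l \<circ> \<nu>) = \<nu>"
    by (simp add: lin_set_jacobian[OF l] flip: o_assoc) (simp add: o_assoc)
qed

lemma comp_lin_part_nil_part: "lin_nil_comp (lin_part \<psi>) (nil_part \<psi>) = \<psi>"
proof transfer
  fix \<psi> :: "real^'n \<Rightarrow> real^'n"
  assume "\<psi> \<in> diff_set"
  then have "surj (\<lambda>x. jacobian \<psi> (at 0) *v x)"
    using linear_part_in_lin_set diff_set_bij by (auto simp: lin_set_def bij_def)
  then show "(\<lambda>x. jacobian \<psi> (at 0) *v x) \<circ> (inv (\<lambda>x. jacobian \<psi> (at 0) *v x) \<circ> \<psi>) = \<psi>"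
    by (simp add: fun_eq_iff surj_f_inv_f)
qed

lemma lin_nil_comp_bij:
  shows "bij (\<lambda>(l, \<nu>). lin_nil_comp l \<nu>)"
    and "inv (\<lambda>(l, \<nu>). lin_nil_comp l \<nu>) = (\<lambda>\<psi>. (lin_part \<psi>, nil_part \<psi>))"
proof -
  show "bij (\<lambda>(l, \<nu>). lin_nil_comp l \<nu>)"
    by (rule bij_betw_byWitness[where f' = "\<lambda>\<psi>. (lin_part \<psi>, nil_part \<psi>)"])
       (auto simp: lin_part_comp nil_part_comp comp_lin_part_nil_part)
  show "inv (\<lambda>(l, \<nu>). lin_nil_comp l \<nu>) = (\<lambda>\<psi>. (lin_part \<psi>, nil_part \<psi>))"
    by (rule inv_equality) (auto simp: lin_part_comp nil_part_comp comp_lin_part_nil_part)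
qed

text \<open>The factor \<open>l'\<close> has to pass to the left of \<open>\<nu>\<close>, and \<open>\<nu> l' = l' (\<nu> \<triangleleft> l')\<close>. So the left-hand side is the
  product that makes \<open>(l, \<nu>) \<mapsto> l \<circ> \<nu>\<close> a homomorphism.\<close>

lemma lin_nil_comp_mult:
  "lin_nil_comp (lin_mult l l') (nil_mult (\<nu> \<triangleleft> l') \<nu>')
    = diff_mult (lin_nil_comp l \<nu>) (lin_nil_comp l' \<nu>')"
proof transfer
  fix l l' \<nu> \<nu>' :: "real^'n \<Rightarrow> real^'n"
  assume "l' \<in> lin_set"
  then have "surj l'" by (auto simp: lin_set_def diff_set_bij bij_is_surj)
  then show "l \<circ> l' \<circ> (inv l' \<circ> \<nu> \<circ> l' \<circ> \<nu>') = l \<circ> \<nu> \<circ> (l' \<circ> \<nu>')"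
    by (simp add: fun_eq_iff surj_f_inv_f)
qed

lemma lin_nil_comp_factor:
  "lin_nil_comp l \<nu> = diff_mult (lin_nil_comp l nil_one) (lin_nil_comp lin_one \<nu>)"
  by transfer simp

lemma lin_nil_comp_one: "lin_nil_comp lin_one nil_one = diff_one"
  by transfer simp

lemma group_diff: "group diff_mult diff_one diff_inv"
proof
  show "diff_mult (diff_mult \<phi> \<psi>) \<omega> = diff_mult \<phi> (diff_mult \<psi> \<omega>)" for \<phi> \<psi> \<omega> :: "'n::finite diff_grp"
    by transfer (simp add: o_assoc)
  show "diff_mult diff_one \<psi> = \<psi>" for \<psi> :: "'n::finite diff_grp"
    by transfer simp
  show "diff_mult (diff_inv \<psi>) \<psi> = diff_one" for \<psi> :: "'n::finite diff_grp"
    by transfer (simp add: diff_set_bij bij_is_inj)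
qed

section \<open>Regular functions on the two factors\<close>

text \<open>The factors are embedded in \<open>G\<dagger>\<close> as \<open>l \<circ> id\<close> and \<open>id \<circ> \<nu>\<close>. Below, regular functions on \<open>G\<dagger>\<close> are
  restricted to the factors along these embeddings, and regular functions on the factors are
  pulled back to \<open>G\<dagger>\<close> along the projections \<open>lin_part\<close> and \<open>nil_part\<close>.\<close>

definition coord_lin :: "('n::finite lin_grp \<Rightarrow> 'k::real_field) set" where
  "coord_lin = generated_algebra (insert alpha_lin_inv {alpha_lin i j | i j. True})"

definition coord_nil :: "('n::finite nil_grp \<Rightarrow> 'k::real_field) set" where
  "coord_nil = generated_algebra {alpha_nil i js | i js. length js \<ge> 2}"

lemma function_algebra_coord_lin: "function_algebra coord_lin"
  unfolding coord_lin_def by (rule function_algebra_generated)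

lemma function_algebra_coord_nil: "function_algebra coord_nil"
  unfolding coord_nil_def by (rule function_algebra_generated)

lemma beta_lin:
  fixes l :: "'n::finite lin_grp"
  shows "beta_inv (lin_nil_comp l nil_one) = alpha_lin_inv l"
    and "beta i [j] (lin_nil_comp l nil_one) = alpha_lin i j l"
    and "beta i (j # k # js) (lin_nil_comp l nil_one) = 0"
proof -
  have m: "diff_map (lin_nil_comp l nil_one) = lin_map l"
    by transfer simp
  show "beta_inv (lin_nil_comp l nil_one) = alpha_lin_inv l"
    by (simp add: beta_inv_def alpha_lin_inv_def m)
  show "beta i [j] (lin_nil_comp l nil_one) = alpha_lin i j l"
    by (simp add: beta_def alpha_lin_def m iter_partial_def)
  obtain a where a: "lin_map l = (\<lambda>x. a *v x)" "smooth_map (lin_map l)"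
    using lin_map[of l] by (auto simp: lin_set_def diff_set_def orientation_preserving_diffeo_def)
  have "partial_deriv j (\<lambda>x. lin_map l x $ i) = (\<lambda>x. a $ i $ j)"
    using partial_deriv_jacobian[OF a(2)] by (simp add: a(1) jacobian_matrix fun_eq_iff)
  moreover have "iter_partial js (\<lambda>_::real^'n. 0) = (\<lambda>_. 0)"
    by (induction js) (simp_all add: iter_partial_def partial_deriv_const)
  ultimately show "beta i (j # k # js) (lin_nil_comp l nil_one) = 0"
    by (simp add: beta_def m iter_partial_Cons partial_deriv_const)
qed

lemma beta_nil:
  shows "beta_inv (lin_nil_comp lin_one \<nu>) = 1"
    and "beta i [j] (lin_nil_comp lin_one \<nu>) = of_real (mat 1 $ i $ j)"
    and "beta i js (lin_nil_comp lin_one \<nu>) = alpha_nil i js \<nu>"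
proof -
  have m: "diff_map (lin_nil_comp lin_one \<nu>) = nil_map \<nu>"
    by transfer simp
  have J: "jacobian (nil_map \<nu>) (at 0) = mat 1" "smooth_map (nil_map \<nu>)"
    using nil_map[of \<nu>] by (auto simp: nil_set_def diff_set_def orientation_preserving_diffeo_def)
  show "beta_inv (lin_nil_comp lin_one \<nu>) = 1"
    by (simp add: beta_inv_def m J)
  show "beta i [j] (lin_nil_comp lin_one \<nu>) = of_real (mat 1 $ i $ j)"
    using partial_deriv_jacobian[OF J(2), of j i 0]
    by (simp add: beta_def m J iter_partial_def)
  show "beta i js (lin_nil_comp lin_one \<nu>) = alpha_nil i js \<nu>"
    by (simp add: beta_def alpha_nil_def m)
qed

lemma coord_diff_restrict_lin:
  fixes f :: "'n::finite diff_grp \<Rightarrow> 'k::real_field"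
  assumes "f \<in> coord_diff"
  shows "(\<lambda>l. f (lin_nil_comp l nil_one)) \<in> coord_lin"
proof (rule coord_diff_pullback[OF assms function_algebra_coord_lin])
  show "(\<lambda>l. beta_inv (lin_nil_comp l nil_one)) \<in> coord_lin"
    unfolding beta_lin coord_lin_def by (rule generated_algebra.gen) auto
  show "(\<lambda>l. beta i js (lin_nil_comp l nil_one)) \<in> coord_lin" if "js \<noteq> []" for i :: 'n and js
  proof -
    from that consider j where "js = [j]" | j k ks where "js = j # k # ks"
      by (metis list.exhaust)
    then show ?thesis
    proof cases
      case 1
      show ?thesis
        unfolding 1 beta_lin coord_lin_def by (rule generated_algebra.gen) blast
    next
      case 2
      then show ?thesis
        by (simp add: beta_lin function_algebra_const[OF function_algebra_coord_lin])
    qed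
  qed
qed

lemma coord_diff_restrict_nil:
  fixes f :: "'n::finite diff_grp \<Rightarrow> 'k::real_field"
  assumes "f \<in> coord_diff"
  shows "(\<lambda>\<nu>. f (lin_nil_comp lin_one \<nu>)) \<in> coord_nil"
proof (rule coord_diff_pullback[OF assms function_algebra_coord_nil])
  note const = function_algebra_const[OF function_algebra_coord_nil]
  show "(\<lambda>\<nu>. beta_inv (lin_nil_comp lin_one \<nu>)) \<in> coord_nil"
    by (simp add: beta_nil const)
  show "(\<lambda>\<nu>. beta i js (lin_nil_comp lin_one \<nu>)) \<in> coord_nil" if nonempty: "js \<noteq> []" for i :: 'n and js
  proof (cases "length js \<ge> 2")
    case True
    then show ?thesis
      unfolding beta_nil(3) coord_nil_def by (intro generated_algebra.gen) blast
  next
    case False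
    then obtain j where "js = [j]"
      using nonempty by (cases js) (auto simp: not_le less_Suc_eq)
    then show ?thesis by (simp add: beta_nil(2) const)
  qed
qed

lemma coord_lin_extend:
  assumes "f \<in> coord_lin"
  shows "(\<lambda>\<psi>. f (lin_part \<psi>)) \<in> coord_diff"
proof (rule generated_algebra_pullback[OF assms[unfolded coord_lin_def] function_algebra_coord_diff])
  have m: "lin_map (lin_part \<psi>) = (\<lambda>x. jacobian (diff_map \<psi>) (at 0) *v x)" for \<psi> :: "'a diff_grp"
    by transfer simp
  have "alpha_lin_inv (lin_part \<psi>) = (beta_inv \<psi> :: 'b)" for \<psi> :: "'a diff_grp"
    by (simp add: alpha_lin_inv_def beta_inv_def m jacobian_matrix)
  moreover have "alpha_lin i j (lin_part \<psi>) = (beta i [j] \<psi> :: 'b)" for i j and \<psi> :: "'a diff_grp"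
    using partial_deriv_jacobian[OF smooth_map_linear[OF matrix_vector_mul_linear]]
    by (simp add: alpha_lin_def beta_def m iter_partial_def partial_deriv_jacobian diff_map_smooth
        jacobian_matrix)
  ultimately show "(\<lambda>\<psi>. b (lin_part \<psi>)) \<in> coord_diff"
    if "b \<in> insert alpha_lin_inv {alpha_lin i j | i j. True}" for b :: "'a lin_grp \<Rightarrow> 'b"
    using that by (auto simp: beta_inv_in_coord_diff beta_in_coord_diff)
qed

text \<open>The projection is \<open>\<psi> \<mapsto> l\<^sup>-\<^sup>1 \<circ> \<psi>\<close> with \<open>l\<close> the linear part of \<open>\<psi>\<close>. So \<open>\<alpha>(\<nu>)\<close> is the coproduct of \<open>\<beta>\<close> at
  \<open>(l\<^sup>-\<^sup>1, \<psi>)\<close>, and in the first argument the antipode, restriction to linear maps and pullback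
  along the linear part preserve regularity.\<close>

lemma coord_nil_extend:
  assumes "g \<in> coord_nil"
  shows "(\<lambda>\<psi>. g (nil_part \<psi>)) \<in> coord_diff"
proof (rule generated_algebra_pullback[OF assms[unfolded coord_nil_def] function_algebra_coord_diff])
  fix b :: "'a nil_grp \<Rightarrow> 'b"
  assume "b \<in> {alpha_nil i js | i js. length js \<ge> 2}"
  then obtain i js where b: "b = alpha_nil i js" and "length js \<ge> 2" by blast
  then have js: "js \<noteq> []" by auto
  have eq: "lin_nil_comp lin_one (nil_part \<psi>)
      = diff_mult (diff_inv (lin_nil_comp (lin_part \<psi>) nil_one)) \<psi>" for \<psi> :: "'a diff_grp"
    by transfer (simp add: fun_eq_iff)
  have "(\<lambda>\<psi>. (\<lambda>(\<phi>, \<psi>). beta i js (diff_mult \<phi> \<psi>))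
      (diff_inv (lin_nil_comp (lin_part \<psi>) nil_one), \<psi>)) \<in> (coord_diff :: ('a diff_grp \<Rightarrow> 'b) set)"
    by (rule function_tensor_pullback[OF coord_diff_mult[OF beta_in_coord_diff[OF js]]
          function_algebra_coord_diff])
       (rule coord_lin_extend[OF coord_diff_restrict_lin[OF coord_diff_inv]])
  then show "(\<lambda>\<psi>. b (nil_part \<psi>)) \<in> coord_diff"
    by (simp add: b beta_nil(3)[symmetric] eq)
qed

section \<open>The bicrossed product decomposition\<close>

theorem proposition2p4:
  shows "hopf_iso (F_diff :: ('n::finite diff_grp, 'k::real_field) hopf)
           (bicrossed_product F_lin F_nil coaction) Phi"
proof -
  let ?\<theta> = "\<lambda>(l, \<nu>). lin_nil_comp l \<nu> :: 'n diff_grp"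
  let ?mul = "\<lambda>(l, \<nu>) (l', \<nu>'). (lin_mult l l', nil_mult (\<nu> \<triangleleft> l') \<nu>') :: 'n lin_grp \<times> 'n nil_grp"
  let ?B = "coord_lin \<otimes>\<^sub>f coord_nil :: ('n lin_grp \<times> 'n nil_grp \<Rightarrow> 'k) set"
  let ?K = "bicrossed_product F_lin F_nil coaction :: ('n lin_grp \<times> 'n nil_grp, 'k) hopf"
  have B: "function_algebra ?B"
    by (intro function_algebra_tensor function_algebra_coord_lin function_algebra_coord_nil)
  \<comment> \<open>\<open>l \<circ> \<nu>\<close> is a product in \<open>G\<dagger>\<close>, so \<open>\<Phi> f\<close> is a restriction of the coproduct of \<open>f\<close>.\<close>
  have Phi: "(\<lambda>p. f (?\<theta> p)) \<in> ?B" if f: "f \<in> coord_diff" for f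
  proof -
    have "(\<lambda>p. (\<lambda>(\<phi>, \<psi>). f (diff_mult \<phi> \<psi>))
        (lin_nil_comp (fst p) nil_one, lin_nil_comp lin_one (snd p))) \<in> ?B"
      by (rule function_tensor_pullback[OF coord_diff_mult[OF f] B])
         (intro function_tensor_fst[OF function_algebra_coord_nil coord_diff_restrict_lin]
            function_tensor_snd[OF function_algebra_coord_lin coord_diff_restrict_nil], assumption)+
    then show ?thesis
      by (simp add: split_beta' flip: lin_nil_comp_factor)
  qed
  have Psi: "(\<lambda>\<psi>. F (inv ?\<theta> \<psi>)) \<in> coord_diff" if F: "F \<in> ?B" for F
    unfolding lin_nil_comp_bij(2)
    by (rule function_tensor_pullback[OF F function_algebra_coord_diff coord_lin_extend coord_nil_extend])
  have "hopf_iso (group_function_hopf coord_diff diff_mult diff_one diff_inv) ?K (\<lambda>f p. f (?\<theta> p))"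
  proof (rule hopf_iso_pullback[OF group_diff function_algebra_coord_diff coord_diff_mult coord_diff_inv
        lin_nil_comp_bij(1) _ _ B Phi Psi])
    show "?\<theta> (?mul p q) = diff_mult (?\<theta> p) (?\<theta> q)" for p q
      by (simp add: lin_nil_comp_mult split: prod.split)
    show "?\<theta> (lin_one, nil_one) = diff_one"
      by (simp add: lin_nil_comp_one)
    show "hcarrier ?K = ?B"
      by (simp add: bicrossed_product_def Let_def F_lin_def F_nil_def group_function_hopf_def coord_lin_def
          coord_nil_def)
    then show "antipode ?K = (SOME S. is_antipode ?B (comult ?K) (counit ?K) S)"
      by (simp add: bicrossed_product_def Let_def)
    show "comult ?K = (\<lambda>F (p, q). F (?mul p q))"
      by (simp add: bicrossed_product_def Let_def bicrossed_comult_def tensor_map_def F_lin_def F_nil_def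
          group_function_hopf_def coaction_def fun_eq_iff)
    show "counit ?K = (\<lambda>F. F (lin_one, nil_one))"
      by (simp add: bicrossed_product_def Let_def F_lin_def F_nil_def group_function_hopf_def)
  qed
  moreover have "(Phi :: ('n diff_grp \<Rightarrow> 'k) \<Rightarrow> _) = (\<lambda>f p. f (?\<theta> p))"
    by (simp add: Phi_def fun_eq_iff)
  ultimately show ?thesis
    by (simp only: F_diff_def coord_diff_def)
qed

end
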